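(* Let $\mu$ be a finite positive Borel measure on $\overline{\mathbb D}$ and let $f\in\mathcal D_\mu$. For $0\le r<1$ let $f_r(z):=f(rz)$. Then $$\mathcal D_\mu(f_r)\le\frac{2r}{1+r}\,\mathcal D_\mu(f)\qquad(0\le r<1).$$
   Context: $\mathbb D$ is the open unit disk, $\mathbb T$ the unit circle, $dA$ the normalized area measure on $\mathbb D$ (so $A(\mathbb D)=1$), $\mathrm{Hol}(\mathbb D)$ the space of holomorphic functions on $\mathbb D$. For a finite positive Borel measure $\mu$ on $\overline{\mathbb D}$, define the positive superharmonic function $$\omega(z)=\int_{\mathbb D}\log\Bigl|\frac{1-\overline{\zeta}z}{\zeta-z}\Bigr|\frac{2}{1-|\zeta|^2}\,d\mu(\zeta)+\int_{\mathbb T}\frac{1-|z|^2}{|\zeta-z|^2}\,d\mu(\zeta)\qquad(z\in\mathbb D).$$ (Every positive superharmonic function $\omega$ on $\mathbb D$ has this form for a unique such $\mu$, and $\omega\in L^1(\mathbb D)$.) For $f\in\mathrm{Hol}(\mathbb D)$ put $$\mathcal D_\mu(f):=\int_{\mathbb D}|f'(z)|^2\,\omega(z)\,dA(z),$$ and let $\mathcal D_\mu$ be the set of $f\in\mathrm{Hol}(\mathbb D)$ with $\mathcal D_\mu(f)<\infty$. *)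

theory Defs
  imports "HOL-Complex_Analysis.Complex_Analysis"
begin

definition finite_borel_measure_on_cdisk :: "complex measure \<Rightarrow> bool" where
  "finite_borel_measure_on_cdisk \<mu> \<longleftrightarrow>
     finite_measure \<mu> \<and> sets \<mu> = sets (restrict_space borel (cball 0 1))"

abbreviation disk_area :: "complex measure" where
  "disk_area \<equiv> uniform_measure lborel (ball 0 1)"

text \<open>
  The kernel is \<open>\<infinity>\<close> on the diagonal. This has to be said explicitly, because HOL's
  totalised division and logarithm would give \<open>0\<close> there, and \<open>\<mu>\<close> may have atoms.
  For distinct points of the disk the logarithm is positive, so \<^const>\<open>ennreal\<close>
  truncates nothing.
\<close>

definition log_kernel :: "complex \<Rightarrow> complex \<Rightarrow> ennreal" where
  "log_kernel z \<zeta> =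
     (if \<zeta> = z then \<infinity> else ennreal (ln (cmod ((1 - cnj \<zeta> * z) / (\<zeta> - z)))))"

text \<open>Only the values for \<open>z\<close> in the open unit disk are meaningful.\<close>

definition superharmonic_weight :: "complex measure \<Rightarrow> complex \<Rightarrow> ennreal" where
  "superharmonic_weight \<mu> z =
     (\<integral>\<^sup>+ \<zeta> \<in> ball 0 1. log_kernel z \<zeta> * ennreal (2 / (1 - (cmod \<zeta>)\<^sup>2)) \<partial>\<mu>) +
     (\<integral>\<^sup>+ \<zeta> \<in> sphere 0 1. ennreal ((1 - (cmod z)\<^sup>2) / (cmod (\<zeta> - z))\<^sup>2) \<partial>\<mu>)"

definition dirichlet_integral :: "complex measure \<Rightarrow> (complex \<Rightarrow> complex) \<Rightarrow> ennreal" where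
  "dirichlet_integral \<mu> f =
     (\<integral>\<^sup>+ z \<in> ball 0 1. ennreal ((cmod (deriv f z))\<^sup>2) * superharmonic_weight \<mu> z \<partial>disk_area)"

definition dirichlet_space :: "complex measure \<Rightarrow> (complex \<Rightarrow> complex) set" where
  "dirichlet_space \<mu> = {f. f holomorphic_on ball 0 1 \<and> dirichlet_integral \<mu> f < \<infinity>}"

end

theory Submission
  imports Defs
begin

text \<open>
  The argument only uses that the weight \<open>\<omega>\<close> is nonnegative and dominates its circular means.
  Write \<open>u = |f'|\<^sup>2\<close>, a nonnegative subharmonic function, and \<open>E\<close> for the Euler operator
  \<open>x \<partial>\<^sub>x + y \<partial>\<^sub>y\<close>. From
  \<open>\<Delta>((R\<^sup>2 - |z|\<^sup>2) u) = (R\<^sup>2 - |z|\<^sup>2) \<Delta>u - 4 (u + E u)\<close> and \<open>\<Delta>u \<ge> 0\<close> one gets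
  \<open>4 (u + E u) \<ge> -\<Delta>((R\<^sup>2 - |z|\<^sup>2) u)\<close> on \<open>|z| < R\<close>. Moving the Laplacian, in the form of
  a difference between a function and its mean over small circles, onto \<open>\<omega>\<close> shows that
  \<open>\<integral> \<omega> (u + E u) \<ge> 0\<close> over \<open>|z| < R\<close>. The same holds for the dilates \<open>u (t z)\<close>, for which
  \<open>u + E u\<close> is the \<open>t\<close>-derivative of \<open>t u (t z)\<close>. Integration over \<open>r \<le> t \<le> 1\<close> gives
  \<open>\<integral> \<omega> r u (r z) \<le> \<integral> \<omega> u\<close>, that is, the asserted inequality with the constant
  \<open>r \<le> 2 r / (1 + r)\<close>. Replacing \<open>\<omega>\<close> by \<open>min \<omega> k\<close>, which also dominates its
  means, removes all integrability questions.
\<close>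

section \<open>Normalized arc length on the unit circle and the mean value property\<close>

text \<open>The measure lives on the sphere itself, with the restricted sigma-algebra, so a function
  that is merely continuous on the circle is measurable without any extension to the plane. The
  parameter interval has length 1, which makes the total mass 1.\<close>

definition circle_unif :: "complex measure" where
  "circle_unif = distr (restrict_space lborel {0..1}) (restrict_space borel (sphere 0 1))
     (\<lambda>t. exp (2 * of_real pi * \<i> * of_real t))"

lemma circle_param_measurable:
  "(\<lambda>t::real. exp (2 * of_real pi * \<i> * of_real t))
     \<in> measurable (restrict_space lborel {0..1}) (restrict_space borel (sphere 0 1))"
  by (rule measurable_restrict_space2)
     (auto simp: norm_exp intro!: borel_measurable_continuous_onI continuous_intros measurable_restrict_space1)

lemma space_circle_unif [simp]: "space circle_unif = sphere 0 1"
  and sets_circle_unif [measurable_cong]: "sets circle_unif = sets (restrict_space borel (sphere 0 1))"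
  by (simp_all add: circle_unif_def space_restrict_space)

lemma emeasure_circle_unif: "emeasure circle_unif (sphere 0 1) = 1"
proof -
  have "sphere 0 1 \<in> sets (restrict_space borel (sphere 0 1 :: complex set))"
    by (simp add: sets_restrict_space_iff)
  then have "emeasure circle_unif (sphere 0 1) =
      emeasure (restrict_space lborel {0..1::real}) (space (restrict_space lborel {0..1}))"
    unfolding circle_unif_def
    by (subst emeasure_distr[OF circle_param_measurable])
       (auto simp: space_restrict_space norm_exp intro!: arg_cong2[where f = emeasure])
  then show ?thesis
    by (simp add: space_restrict_space emeasure_restrict_space)
qed

interpretation circle: finite_measure circle_unif
  by (rule finite_measureI) (simp add: emeasure_circle_unif)

lemma measure_circle_unif [simp]: "measure circle_unif (sphere 0 1) = 1"
  by (simp add: measure_def emeasure_circle_unif)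

lemma continuous_on_measurable_circle:
  fixes G :: "complex \<Rightarrow> 'a::topological_space"
  assumes "continuous_on (sphere 0 1) G"
  shows "G \<in> borel_measurable circle_unif"
  using borel_measurable_continuous_on_restrict[OF assms]
  by (simp add: measurable_cong_sets[OF sets_circle_unif refl])

lemma continuous_on_integrable_circle:
  fixes G :: "complex \<Rightarrow> 'a::{banach, second_countable_topology}"
  assumes "continuous_on (sphere 0 1) G"
  shows "integrable circle_unif G"
proof -
  have "bounded (G ` sphere 0 1)"
    by (intro compact_imp_bounded compact_continuous_image assms) auto
  then obtain B where "\<And>w. w \<in> sphere 0 1 \<Longrightarrow> norm (G w) \<le> B"
    unfolding bounded_iff by blast
  then show ?thesis
    by (intro circle.integrable_const_bound[where B = B] AE_I2 continuous_on_measurable_circle assms) auto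
qed

text \<open>Cauchy's integral formula at the centre. The radius \<open>s > 1\<close> makes
  \<open>G\<close> holomorphic on a neighbourhood of the closed unit disk.\<close>

lemma circle_mean_value:
  fixes G :: "complex \<Rightarrow> complex"
  assumes hol: "G holomorphic_on ball 0 s" and s: "s > 1"
  shows "integral\<^sup>L circle_unif G = G 0"
proof -
  let ?e = "\<lambda>t::real. exp (2 * of_real pi * \<i> * of_real t)"
  have cont: "continuous_on (ball 0 s) G"
    by (rule holomorphic_on_imp_continuous_on[OF hol])
  have contc: "continuous_on (sphere 0 1) G"
    by (rule continuous_on_subset[OF cont]) (use s in auto)
  have conte: "continuous_on {0..1} (\<lambda>t. G (?e t))"
    by (rule continuous_on_compose2[OF cont]) (use s in \<open>auto intro!: continuous_intros simp: norm_exp\<close>)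
  have "G holomorphic_on cball 0 1"
    by (rule holomorphic_on_subset[OF hol]) (use s in auto)
  then have "((\<lambda>u. G u / (u - 0)) has_contour_integral (2 * of_real pi * \<i> * G 0)) (circlepath 0 1)"
    by (rule Cauchy_integral_circlepath_simple) auto
  \<comment> \<open>On the unit circle \<open>du / u\<close> is \<open>2 * pi * \<i> * dt\<close>,
    so the factor \<open>?e t\<close> cancels and the contour integral becomes a plain
    average.\<close>
  then have "((\<lambda>t. G (?e t) / ?e t * (2 * of_real pi * \<i> * ?e t)) has_integral (2 * of_real pi * \<i> * G 0)) {0..1}"
    unfolding has_contour_integral_def
    by (rule has_integral_eq[rotated])
       (simp add: vector_derivative_circlepath01, simp add: circlepath)
  then have "((\<lambda>t. (2 * of_real pi * \<i>) * G (?e t)) has_integral (2 * of_real pi * \<i> * G 0)) {0..1}"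
    by (rule has_integral_eq[rotated]) simp
  then have "((\<lambda>t. (1 / (2 * of_real pi * \<i>)) * ((2 * of_real pi * \<i>) * G (?e t))) has_integral
      (1 / (2 * of_real pi * \<i>)) * (2 * of_real pi * \<i> * G 0)) {0..1}"
    by (rule has_integral_mult_right)
  then have *: "((\<lambda>t. G (?e t)) has_integral G 0) {0..1}"
    by simp
  have "integral\<^sup>L circle_unif G = integral\<^sup>L (restrict_space lborel {0..1}) (\<lambda>t. G (?e t))"
    unfolding circle_unif_def
    using borel_measurable_continuous_on_restrict[OF contc]
    by (rule integral_distr[OF circle_param_measurable])
  also have "\<dots> = (LINT t:{0..1}|lborel. G (?e t))"
    by (subst integral_restrict_space) (auto simp: set_lebesgue_integral_def)
  also have "\<dots> = integral {0..1} (\<lambda>t. G (?e t))"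
    by (rule set_borel_integral_eq_integral) (rule borel_integrable_atLeastAtMost'[OF conte])
  also have "\<dots> = G 0"
    using * by (rule integral_unique)
  finally show ?thesis .
qed

lemma circle_mean_value_Re:
  assumes hol: "G holomorphic_on ball 0 s" and s: "s > 1"
  shows "(LINT w|circle_unif. Re (G w)) = Re (G 0)"
proof -
  have "integrable circle_unif G"
    by (rule continuous_on_integrable_circle, rule continuous_on_subset[OF holomorphic_on_imp_continuous_on[OF hol]])
       (use s in auto)
  then show ?thesis
    using circle_mean_value[OF assms] by simp
qed

section \<open>Second-order lower bound for circular means of
  \<open>(R\<^sup>2 - |z|\<^sup>2) |F z|\<^sup>2\<close>\<close>

text \<open>To be read with \<open>p = F (z + \<epsilon> * w)\<close>, \<open>q = F z\<close> and
  \<open>d = deriv F z\<close>. The product on the right is expanded so that whatever depends on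
  \<open>w\<close> is either of order \<open>\<epsilon> ^ 3\<close> or the real part of an
  expression that is holomorphic in \<open>w\<close> and vanishes at \<open>w = 0\<close>, hence
  disappears on averaging.\<close>

lemma circle_mean_estimate_pointwise:
  fixes p q d z w :: complex and \<epsilon> R B :: real
  assumes w: "cmod w = 1" and z: "cmod z < R" "R < 1" and eps: "0 < \<epsilon>" "\<epsilon> < 1"
    and q: "cmod q \<le> B" and pq: "cmod (p - q) \<le> B * \<epsilon>" and t: "cmod (p - q - \<epsilon> * w * d) \<le> B * \<epsilon>\<^sup>2"
  defines "c \<equiv> R\<^sup>2 - (cmod z)\<^sup>2 - \<epsilon>\<^sup>2"
  shows "c * (cmod q)\<^sup>2 - 2 * \<epsilon>\<^sup>2 * Re (z * d * cnj q) - 7 * B\<^sup>2 * \<epsilon> ^ 3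
      + Re (2 * c * cnj q * (p - q) - 2 * \<epsilon> * (cmod q)\<^sup>2 * cnj z * w - 2 * \<epsilon>\<^sup>2 * cnj z * cnj q * d * w\<^sup>2)
     \<le> (R\<^sup>2 - (cmod (z + \<epsilon> * w))\<^sup>2) * (cmod p)\<^sup>2"
proof -
  \<comment> \<open>\<open>2 * \<epsilon> * x\<close> is the first-order change of the squared
    modulus from \<open>z\<close> to \<open>z + \<epsilon> * w\<close>; \<open>e\<close> is the part
    of \<open>|p|\<^sup>2\<close> beyond its first-order expansion at \<open>q\<close>.\<close>
  define x where "x = Re (cnj z * w)"
  define e where "e = 2 * Re (cnj q * (p - q - \<epsilon> * w * d)) + (cmod (p - q))\<^sup>2"
  have B: "B \<ge> 0" using q norm_ge_zero order_trans by blast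
  have p2: "(cmod p)\<^sup>2 = (cmod q)\<^sup>2 + 2 * Re (cnj q * (p - q)) + (cmod (p - q))\<^sup>2"
    by (simp only: cmod_power2) (simp add: power2_eq_square algebra_simps)
  have zw: "(cmod (z + \<epsilon> * w))\<^sup>2 = (cmod z)\<^sup>2 + 2 * \<epsilon> * x + \<epsilon>\<^sup>2"
  proof -
    have "(cmod (z + \<epsilon> * w))\<^sup>2 = (cmod z)\<^sup>2 + 2 * \<epsilon> * x + \<epsilon>\<^sup>2 * (cmod w)\<^sup>2"
      unfolding x_def by (simp only: cmod_power2) (simp add: power2_eq_square algebra_simps)
    then show ?thesis using w by simp
  qed
  \<comment> \<open>A product of two real parts splits into \<open>Re (X * Y)\<close> and
    \<open>Re (X * cnj Y)\<close>. Since \<open>|w| = 1\<close>, the second is free of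
    \<open>w\<close>: it is the constant that turns into the Euler term. The first is a multiple of
    \<open>w\<^sup>2\<close> and averages to zero.\<close>
  have cross: "2 * x * Re (cnj q * d * w) = Re (cnj z * cnj q * d * w\<^sup>2) + Re (z * d * cnj q)"
  proof -
    have re: "2 * Re X * Re Y = Re (X * Y) + Re (X * cnj Y)" for X Y :: complex
      by simp
    have "w * cnj w = 1"
      using w by (simp add: complex_norm_square[symmetric])
    moreover have "(cnj z * w) * cnj (cnj q * d * w) = cnj (z * d * cnj q) * (w * cnj w)"
      by (simp add: mult_ac)
    ultimately have 1: "(cnj z * w) * cnj (cnj q * d * w) = cnj (z * d * cnj q)"
      by simp
    have 2: "(cnj z * w) * (cnj q * d * w) = cnj z * cnj q * d * w\<^sup>2"
      by (simp add: power2_eq_square mult_ac)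
    show ?thesis
      unfolding x_def re 1 2 by (simp only: complex_cnj complex.sel cnj.sel)
  qed
  have ax: "\<bar>x\<bar> \<le> 1"
  proof -
    have "\<bar>x\<bar> \<le> cmod (cnj z * w)" unfolding x_def by (rule abs_Re_le_cmod)
    then show ?thesis using w z by (simp add: norm_mult)
  qed
  have pq2: "(cmod (p - q))\<^sup>2 \<le> B\<^sup>2 * \<epsilon>\<^sup>2"
    using power_mono[OF pq, of 2] by (simp add: power_mult_distrib)
  have ae: "\<bar>e\<bar> \<le> 3 * B\<^sup>2 * \<epsilon>\<^sup>2"
  proof -
    have "\<bar>Re (cnj q * (p - q - \<epsilon> * w * d))\<bar> \<le> cmod (cnj q * (p - q - \<epsilon> * w * d))"
      by (rule abs_Re_le_cmod)
    also have "\<dots> \<le> B * (B * \<epsilon>\<^sup>2)"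
      unfolding norm_mult by (rule mult_mono) (use q t B in auto)
    finally have "\<bar>Re (cnj q * (p - q - \<epsilon> * w * d))\<bar> \<le> B\<^sup>2 * \<epsilon>\<^sup>2"
      by (simp only: power2_eq_square mult.assoc)
    then show ?thesis
      using pq2 zero_le_power2[of "cmod (p - q)"] unfolding e_def by linarith
  qed
  have xe: "x * e \<le> 3 * B\<^sup>2 * \<epsilon>\<^sup>2"
  proof -
    have "x * e \<le> \<bar>x\<bar> * \<bar>e\<bar>" by (metis abs_ge_self abs_mult)
    also have "\<dots> \<le> 1 * (3 * B\<^sup>2 * \<epsilon>\<^sup>2)" by (rule mult_mono) (use ax ae in auto)
    finally show ?thesis by simp
  qed
  \<comment> \<open>Discarding this term up to the error is the place where
    \<open>\<Delta>u \<ge> 0\<close> enters. The factor \<open>c\<close> may be negative when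
    \<open>|z|\<close> is close to \<open>R\<close>, but it is at least
    \<open>- \<epsilon>\<^sup>2\<close>.\<close>
  have cpq: "c * (cmod (p - q))\<^sup>2 \<ge> - (B\<^sup>2 * \<epsilon> ^ 3)"
  proof -
    have "(cmod z)\<^sup>2 \<le> R\<^sup>2" using z by (intro power_mono) auto
    then have "- \<epsilon>\<^sup>2 * (cmod (p - q))\<^sup>2 \<le> c * (cmod (p - q))\<^sup>2"
      unfolding c_def by (intro mult_right_mono) auto
    moreover have "\<epsilon>\<^sup>2 * (cmod (p - q))\<^sup>2 \<le> \<epsilon>\<^sup>2 * (B\<^sup>2 * \<epsilon>\<^sup>2)"
      using pq2 by (intro mult_left_mono) auto
    moreover have "\<epsilon>\<^sup>2 * (B\<^sup>2 * \<epsilon>\<^sup>2) = (B\<^sup>2 * \<epsilon> ^ 3) * \<epsilon>"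
      by (simp add: power2_eq_square power3_eq_cube)
    moreover have "(B\<^sup>2 * \<epsilon> ^ 3) * \<epsilon> \<le> B\<^sup>2 * \<epsilon> ^ 3"
      using eps by (intro mult_right_le_one_le) auto
    ultimately show ?thesis by linarith
  qed
  have e3: "2 * \<epsilon> * (x * e) \<le> 6 * B\<^sup>2 * \<epsilon> ^ 3"
  proof -
    have "2 * \<epsilon> * (x * e) \<le> 2 * \<epsilon> * (3 * B\<^sup>2 * \<epsilon>\<^sup>2)"
      using xe eps by (intro mult_left_mono) auto
    then show ?thesis by (simp add: power2_eq_square power3_eq_cube algebra_simps)
  qed
  have e_eq: "(cmod p)\<^sup>2 = (cmod q)\<^sup>2 + 2 * \<epsilon> * Re (cnj q * d * w) + e"
    unfolding e_def p2 by (simp add: algebra_simps)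
  have "(R\<^sup>2 - (cmod (z + \<epsilon> * w))\<^sup>2) * (cmod p)\<^sup>2 = c * (cmod p)\<^sup>2 - 2 * \<epsilon> * x * (cmod p)\<^sup>2"
    unfolding zw c_def by (simp add: algebra_simps)
  also have "\<dots> = c * ((cmod q)\<^sup>2 + 2 * Re (cnj q * (p - q)) + (cmod (p - q))\<^sup>2)
      - 2 * \<epsilon> * x * ((cmod q)\<^sup>2 + 2 * \<epsilon> * Re (cnj q * d * w) + e)"
    using p2 e_eq by simp
  also have "\<dots> = c * (cmod q)\<^sup>2 + 2 * c * Re (cnj q * (p - q)) + c * (cmod (p - q))\<^sup>2
      - 2 * \<epsilon> * (cmod q)\<^sup>2 * x - 2 * \<epsilon>\<^sup>2 * (2 * x * Re (cnj q * d * w)) - 2 * \<epsilon> * (x * e)"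
    by (simp only: power2_eq_square) (simp add: algebra_simps)
  also have "\<dots> \<ge> c * (cmod q)\<^sup>2 + 2 * c * Re (cnj q * (p - q)) - B\<^sup>2 * \<epsilon> ^ 3
      - 2 * \<epsilon> * (cmod q)\<^sup>2 * x - 2 * \<epsilon>\<^sup>2 * (2 * x * Re (cnj q * d * w)) - 6 * B\<^sup>2 * \<epsilon> ^ 3"
    using cpq e3 by linarith
  moreover have "Re (2 * c * cnj q * (p - q) - 2 * \<epsilon> * (cmod q)\<^sup>2 * cnj z * w - 2 * \<epsilon>\<^sup>2 * cnj z * cnj q * d * w\<^sup>2)
     = 2 * c * Re (cnj q * (p - q)) - 2 * \<epsilon> * (cmod q)\<^sup>2 * x - 2 * \<epsilon>\<^sup>2 * Re (cnj z * cnj q * d * w\<^sup>2)"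
  proof -
    have "2 * c * cnj q * (p - q) - 2 * \<epsilon> * (cmod q)\<^sup>2 * cnj z * w - 2 * \<epsilon>\<^sup>2 * cnj z * cnj q * d * w\<^sup>2
      = of_real (2 * c) * (cnj q * (p - q)) - of_real (2 * \<epsilon> * (cmod q)\<^sup>2) * (cnj z * w)
        - of_real (2 * \<epsilon>\<^sup>2) * (cnj z * cnj q * d * w\<^sup>2)"
      by (simp add: mult_ac)
    then show ?thesis
      by (simp only: minus_complex.sel Re_complex_of_real Im_complex_of_real times_complex.sel(1) x_def)
  qed
  ultimately show ?thesis
    unfolding cross by (simp add: algebra_simps)
qed

text \<open>A quantitative form of \<open>\<Delta>b \<ge> - 4 (u + E u)\<close> for
  \<open>b = (R\<^sup>2 - |z|\<^sup>2) u\<close> with \<open>u = |F|\<^sup>2\<close>: to third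
  order, a mean over a circle of radius \<open>\<epsilon>\<close> exceeds the central value by
  \<open>\<epsilon>\<^sup>2 / 4\<close> times the Laplacian. The constants come from bounds on
  \<open>F\<close> and its first two derivatives on a compact disk, so they are uniform in
  \<open>z\<close>.\<close>

lemma circle_mean_estimate:
  assumes hol: "F holomorphic_on ball 0 1" and R: "0 < R" "R < 1"
  shows "\<exists>\<epsilon>0 K. 0 < \<epsilon>0 \<and> R + \<epsilon>0 < 1 \<and>
    (\<forall>\<epsilon> z. 0 < \<epsilon> \<longrightarrow> \<epsilon> < \<epsilon>0 \<longrightarrow> cmod z < R \<longrightarrow>
       (R\<^sup>2 - (cmod z)\<^sup>2) * (cmod (F z))\<^sup>2 - \<epsilon>\<^sup>2 * ((cmod (F z))\<^sup>2 + 2 * Re (z * deriv F z * cnj (F z))) - K * \<epsilon> ^ 3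
       \<le> (LINT w|circle_unif. (R\<^sup>2 - (cmod (z + \<epsilon> * w))\<^sup>2) * (cmod (F (z + \<epsilon> * w)))\<^sup>2))"
proof -
  \<comment> \<open>A radius halfway between \<open>R\<close> and 1 leaves room for a circle of
    radius \<open>\<epsilon> < R' - R\<close> about every point of the smaller disk.\<close>
  define R' where "R' = (1 + R) / 2"
  define S :: "complex set" where "S = cball 0 R'"
  have R': "R < R'" "R' < 1" using R by (auto simp: R'_def)
  have S: "S \<subseteq> ball 0 1" "compact S" "convex S" using R' by (auto simp: S_def)
  have hol': "deriv F holomorphic_on ball 0 1" by (rule holomorphic_deriv[OF hol]) auto
  have hol'': "deriv (deriv F) holomorphic_on ball 0 1" by (rule holomorphic_deriv[OF hol']) auto
  have bd: "\<exists>B. \<forall>x\<in>S. cmod (G x) \<le> B" if "G holomorphic_on ball 0 1" for G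
  proof -
    have "bounded (G ` S)"
      using S holomorphic_on_imp_continuous_on[OF that]
      by (intro compact_imp_bounded compact_continuous_image) (auto intro: continuous_on_subset)
    then show ?thesis by (auto simp: bounded_iff)
  qed
  obtain B0 B1 B2 where B012: "\<And>x. x \<in> S \<Longrightarrow> cmod (F x) \<le> B0" "\<And>x. x \<in> S \<Longrightarrow> cmod (deriv F x) \<le> B1"
      "\<And>x. x \<in> S \<Longrightarrow> cmod (deriv (deriv F) x) \<le> B2"
    using bd[OF hol] bd[OF hol'] bd[OF hol''] by metis
  define B where "B = Max {B0, B1, B2}"
  have B: "cmod (F x) \<le> B" "cmod (deriv F x) \<le> B" "cmod (deriv (deriv F) x) \<le> B" if "x \<in> S" for x
    using B012[OF that] by (auto simp: B_def)
  have d1: "(F has_field_derivative deriv F x) (at x within S)" if "x \<in> S" for x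
    using holomorphic_derivI[OF hol _] that S by blast
  have d2: "(deriv F has_field_derivative deriv (deriv F) x) (at x within S)" if "x \<in> S" for x
    using holomorphic_derivI[OF hol' _] that S by blast
  show ?thesis
  proof (rule exI[of _ "R' - R"], rule exI[of _ "7 * B\<^sup>2"], intro conjI allI impI)
    show "0 < R' - R" "R + (R' - R) < 1" using R' by auto
    fix \<epsilon> z assume eps: "0 < \<epsilon>" "\<epsilon> < R' - R" and z: "cmod z < R"
    define q where "q = F z"
    define d where "d = deriv F z"
    define c where "c = R\<^sup>2 - (cmod z)\<^sup>2 - \<epsilon>\<^sup>2"
    \<comment> \<open>The terms under \<open>Re\<close> in the pointwise estimate, as a function of
      \<open>w\<close>. It is holomorphic with \<open>H 0 = 0\<close>, so its real part has mean
      zero.\<close>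
    define H where "H = (\<lambda>w::complex. 2 * complex_of_real c * cnj q * (F (z + \<epsilon> * w) - q) - 2 * \<epsilon> * (cmod q)\<^sup>2 * cnj z * w - 2 * \<epsilon>\<^sup>2 * cnj z * cnj q * d * w\<^sup>2)"
    \<comment> \<open>For \<open>|w| < s\<close> the point \<open>z + \<epsilon> * w\<close> stays
      within radius \<open>R'\<close>; the choice of \<open>\<epsilon>\<close> makes
      \<open>s\<close> exceed 1, as the mean value property requires.\<close>
    define s where "s = (R' - R) / \<epsilon>"
    have s: "s > 1" using eps by (simp add: s_def)
    have zS: "z \<in> S" using z R' by (simp add: S_def)
    have inD: "cmod (z + \<epsilon> * w) < R'" if "cmod w < s" for w :: complex
    proof -
      have "cmod (z + \<epsilon> * w) \<le> cmod z + \<epsilon> * cmod w"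
        using norm_triangle_ineq[of z "\<epsilon> * w"] eps by (simp add: norm_mult)
      also have "\<epsilon> * cmod w < R' - R" using that eps by (simp add: s_def field_simps)
      finally show ?thesis using z by simp
    qed
    have Fw: "(\<lambda>w::complex. F (z + \<epsilon> * w)) holomorphic_on ball 0 s"
    proof (rule holomorphic_on_compose_gen[OF _ hol, unfolded o_def])
      show "(\<lambda>w::complex. z + \<epsilon> * w) holomorphic_on ball 0 s" by (intro holomorphic_intros)
      show "(\<lambda>w::complex. z + \<epsilon> * w) ` ball 0 s \<subseteq> ball 0 1"
        using less_trans[OF inD R'(2)] by auto
    qed
    have "H holomorphic_on ball 0 s"
      unfolding H_def by (intro holomorphic_intros Fw)
    note H_hol = this
    have H_mean: "(LINT w|circle_unif. Re (H w)) = 0"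
      using circle_mean_value_Re[OF H_hol s] by (simp add: H_def q_def)
    have cFw: "continuous_on (sphere 0 1) (\<lambda>w::complex. F (z + \<epsilon> * w))"
      by (rule continuous_on_subset[OF holomorphic_on_imp_continuous_on[OF Fw]]) (use s in auto)
    have cH: "continuous_on (sphere 0 1) H"
      by (rule continuous_on_subset[OF holomorphic_on_imp_continuous_on[OF H_hol]]) (use s in auto)
    have iH: "integrable circle_unif (\<lambda>w. Re (H w))"
      by (intro continuous_on_integrable_circle continuous_intros cH)
    define k where "k = c * (cmod q)\<^sup>2 - 2 * \<epsilon>\<^sup>2 * Re (z * d * cnj q) - 7 * B\<^sup>2 * \<epsilon> ^ 3"
    have "(R\<^sup>2 - (cmod z)\<^sup>2) * (cmod q)\<^sup>2 - \<epsilon>\<^sup>2 * ((cmod q)\<^sup>2 + 2 * Re (z * d * cnj q)) - 7 * B\<^sup>2 * \<epsilon> ^ 3 = k"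
      by (simp add: k_def c_def algebra_simps)
    also have "k = (LINT w|circle_unif. k + Re (H w))"
      using iH H_mean by (subst Bochner_Integration.integral_add) auto
    also have "\<dots> \<le> (LINT w|circle_unif. (R\<^sup>2 - (cmod (z + \<epsilon> * w))\<^sup>2) * (cmod (F (z + \<epsilon> * w)))\<^sup>2)"
    proof (rule integral_mono)
      show "integrable circle_unif (\<lambda>w. k + Re (H w))" using iH by simp
      show "integrable circle_unif (\<lambda>w. (R\<^sup>2 - (cmod (z + \<epsilon> * w))\<^sup>2) * (cmod (F (z + \<epsilon> * w)))\<^sup>2)"
        by (intro continuous_on_integrable_circle continuous_intros cFw)
      fix w assume "w \<in> space circle_unif"
      then have w: "cmod w = 1" by simp
      define p where "p = F (z + \<epsilon> * w)"
      \<comment> \<open>The sequence of derivatives to which Taylor's theorem is applied, only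
        indices up to 2 being relevant. Order 0 bounds \<open>p - q\<close> by a multiple of
        \<open>\<epsilon>\<close>, order 1 bounds the remainder after the linear term by a multiple
        of \<open>\<epsilon>\<^sup>2\<close>.\<close>
      define G where "G = (\<lambda>i::nat. if i = 0 then F else if i = 1 then deriv F else deriv (deriv F))"
      have p_G: "p = G 0 (z + \<epsilon> * w)" by (simp add: p_def G_def)
      have yS: "z + \<epsilon> * w \<in> S" using inD[of w] w s by (simp add: S_def)
      have "cmod (p - (\<Sum>i\<le>0. G i z * (z + \<epsilon> * w - z) ^ i / fact i))
          \<le> B * cmod (z + \<epsilon> * w - z) ^ Suc 0 / fact 0"
        unfolding p_G
        by (rule complex_Taylor[where f = G and n = 0, OF S(3) _ _ zS yS]) (auto simp: G_def B d1)
      then have pq: "cmod (p - q) \<le> B * \<epsilon>"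
        using w eps by (simp add: q_def norm_mult G_def)
      have "cmod (p - (\<Sum>i\<le>1. G i z * (z + \<epsilon> * w - z) ^ i / fact i))
          \<le> B * cmod (z + \<epsilon> * w - z) ^ Suc 1 / fact 1"
        unfolding p_G
        by (rule complex_Taylor[where f = G and n = 1, OF S(3) _ _ zS yS]) (auto simp: G_def B d1 d2 le_Suc_eq)
      then have t: "cmod (p - q - \<epsilon> * w * d) \<le> B * \<epsilon>\<^sup>2"
        using w eps by (simp add: G_def q_def d_def norm_mult power2_eq_square algebra_simps)
      have q: "cmod q \<le> B" using B zS by (simp add: q_def)
      have e1: "\<epsilon> < 1" using eps R' R by linarith
      show "k + Re (H w) \<le> (R\<^sup>2 - (cmod (z + \<epsilon> * w))\<^sup>2) * (cmod (F (z + \<epsilon> * w)))\<^sup>2"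
        using circle_mean_estimate_pointwise[OF w z R(2) eps(1) e1 q pq t]
        unfolding k_def H_def c_def p_def .
    qed
    finally show "(R\<^sup>2 - (cmod z)\<^sup>2) * (cmod (F z))\<^sup>2 - \<epsilon>\<^sup>2 * ((cmod (F z))\<^sup>2 + 2 * Re (z * deriv F z * cnj (F z))) - 7 * B\<^sup>2 * \<epsilon> ^ 3
       \<le> (LINT w|circle_unif. (R\<^sup>2 - (cmod (z + \<epsilon> * w))\<^sup>2) * (cmod (F (z + \<epsilon> * w)))\<^sup>2)"
      unfolding q_def d_def .
  qed
qed

section \<open>Integration against weights that dominate their circular means\<close>

text \<open>The super-mean-value property, demanded only for circles whose closed disk lies in the
  open unit disk. The radius is encoded as a complex \<open>c\<close>, so the reflected circle with
  \<open>- c\<close> in the adjoint identity is covered directly.\<close>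

definition circle_supermean :: "(complex \<Rightarrow> ennreal) \<Rightarrow> bool" where
  "circle_supermean W \<longleftrightarrow>
     (\<forall>z c. cmod z + cmod c < 1 \<longrightarrow> (\<integral>\<^sup>+w. W (z + c * w) \<partial>circle_unif) \<le> W z)"

lemma borel_measurable_indicator_ball:
  fixes g :: "complex \<Rightarrow> real"
  assumes "continuous_on (ball 0 R) g"
  shows "(\<lambda>z. indicator (ball 0 R) z * g z) \<in> borel_measurable borel"
  using borel_measurable_continuous_on_indicator[OF _ assms] by simp

lemma integrable_ball_weight:
  fixes W g :: "complex \<Rightarrow> real"
  assumes [measurable]: "W \<in> borel_measurable borel" and W: "\<And>z. 0 \<le> W z" "\<And>z. W z \<le> n"
    and g: "continuous_on (ball 0 1) g" and R: "R < 1"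
  shows "integrable lborel (\<lambda>z. indicator (ball 0 R) z * (W z * g z))"
proof -
  have "bounded (g ` cball 0 R)"
    by (intro compact_imp_bounded compact_continuous_image continuous_on_subset[OF g]) (use R in auto)
  then obtain B where B: "\<And>z. z \<in> cball 0 R \<Longrightarrow> \<bar>g z\<bar> \<le> B"
    unfolding bounded_iff real_norm_def by blast
  have cg: "continuous_on (ball 0 R) g" by (rule continuous_on_subset[OF g]) (use R in auto)
  have [measurable]: "(\<lambda>z. indicator (ball 0 R) z * g z) \<in> borel_measurable borel"
    by (rule borel_measurable_indicator_ball[OF cg])
  have "integrable lborel (\<lambda>z. W z * (indicator (ball 0 R) z * g z))"
  proof (rule integrableI_bounded_set[where A = "ball 0 R" and B = "n * B"])
    show "AE z in lborel :: complex measure. z \<in> ball 0 R \<longrightarrow> norm (W z * (indicator (ball 0 R) z * g z)) \<le> n * B"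
    proof (intro AE_I2 impI)
      fix z :: complex assume "z \<in> ball 0 R"
      then have "\<bar>g z\<bar> \<le> B" using B[of z] by auto
      then show "norm (W z * (indicator (ball 0 R) z * g z)) \<le> n * B"
        using W[of z] \<open>z \<in> ball 0 R\<close> by (auto simp: abs_mult intro!: mult_mono)
    qed
  next
    show "emeasure lborel (ball (0::complex) R) < \<infinity>" by (rule emeasure_lborel_ball_finite)
  qed auto
  then show ?thesis by (simp add: mult_ac)
qed

text \<open>\<open>ennreal\<close> sends negative values to 0, so the right-hand side integrates the
  positive part of \<open>f\<close>.\<close>

lemma ennreal_integral_le_nn_integral:
  assumes "integrable M f"
  shows "ennreal (integral\<^sup>L M f) \<le> (\<integral>\<^sup>+x. ennreal (f x) \<partial>M)"
proof -
  have "integral\<^sup>L M f \<le> (LINT x|M. max 0 (f x))"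
    using assms by (intro integral_mono) auto
  then have "ennreal (integral\<^sup>L M f) \<le> ennreal (LINT x|M. max 0 (f x))"
    by (rule ennreal_leI)
  also have "\<dots> = (\<integral>\<^sup>+x. ennreal (max 0 (f x)) \<partial>M)"
    using assms by (intro nn_integral_eq_integral[symmetric]) auto
  also have "\<dots> = (\<integral>\<^sup>+x. ennreal (f x) \<partial>M)"
    by (intro nn_integral_cong) (auto simp: max_def ennreal_neg)
  finally show ?thesis .
qed

text \<open>Tonelli's theorem and translation invariance of Lebesgue measure: substituting
  \<open>z - c * w\<close> for \<open>z\<close> moves the shift from \<open>h\<close> to
  \<open>W\<close>. This is how the difference between a function and its mean is transferred to the
  weight.\<close>

lemma circle_average_selfadjoint:
  fixes W h :: "complex \<Rightarrow> ennreal"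
  assumes [measurable]: "W \<in> borel_measurable borel" "h \<in> borel_measurable borel"
  shows "(\<integral>\<^sup>+z. W z * (\<integral>\<^sup>+w. h (z + c * w) \<partial>circle_unif) \<partial>lborel)
       = (\<integral>\<^sup>+z. h z * (\<integral>\<^sup>+w. W (z + - c * w) \<partial>circle_unif) \<partial>lborel)"
proof -
  interpret P: pair_sigma_finite "lborel :: complex measure" circle_unif
    by (intro pair_sigma_finite.intro lborel.sigma_finite_measure_axioms circle.sigma_finite_measure_axioms)
  have [measurable]: "(\<lambda>w. w) \<in> borel_measurable circle_unif"
    by (intro continuous_on_measurable_circle continuous_intros)
  have "(\<integral>\<^sup>+z. W z * (\<integral>\<^sup>+w. h (z + c * w) \<partial>circle_unif) \<partial>lborel)
      = (\<integral>\<^sup>+z. (\<integral>\<^sup>+w. W z * h (z + c * w) \<partial>circle_unif) \<partial>lborel)"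
    by (subst nn_integral_cmult) measurable
  also have "\<dots> = (\<integral>\<^sup>+w. (\<integral>\<^sup>+z. W z * h (z + c * w) \<partial>lborel) \<partial>circle_unif)"
    by (subst P.Fubini') measurable
  also have "\<dots> = (\<integral>\<^sup>+w. (\<integral>\<^sup>+z. W (z + - c * w) * h z \<partial>lborel) \<partial>circle_unif)"
  proof (rule nn_integral_cong)
    fix w
    have "(\<integral>\<^sup>+z. W z * h (z + c * w) \<partial>lborel) = (\<integral>\<^sup>+z. W z * h (z + c * w) \<partial>distr lborel borel ((+) (- c * w)))"
      by (simp add: lborel_distr_plus)
    also have "\<dots> = (\<integral>\<^sup>+z. W (z + - c * w) * h z \<partial>lborel)"
      by (subst nn_integral_distr) (auto simp: add_ac)
    finally show "(\<integral>\<^sup>+z. W z * h (z + c * w) \<partial>lborel) = (\<integral>\<^sup>+z. W (z + - c * w) * h z \<partial>lborel)" .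
  qed
  also have "\<dots> = (\<integral>\<^sup>+z. (\<integral>\<^sup>+w. W (z + - c * w) * h z \<partial>circle_unif) \<partial>lborel)"
    by (subst P.Fubini') measurable
  also have "\<dots> = (\<integral>\<^sup>+z. h z * (\<integral>\<^sup>+w. W (z + - c * w) \<partial>circle_unif) \<partial>lborel)"
    by (subst nn_integral_cmult[symmetric]) (measurable, simp add: mult_ac)
  finally show ?thesis .
qed

text \<open>
  \<open>h\<close> is the function \<open>b z = (R\<^sup>2 - |z|\<^sup>2) |F z|\<^sup>2\<close> cut off at the circle of
  radius \<open>R\<close>, where \<open>b\<close> changes sign, so that \<open>b \<le> h\<close>. Inside that circle the circular
  means of \<open>h\<close> therefore dominate those of \<open>b\<close>, and the boundary contributes nothing.
\<close>

lemma supermean_weight_integral_nonneg: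
  fixes W :: "complex \<Rightarrow> real"
  assumes Wm [measurable]: "W \<in> borel_measurable borel" and W: "\<And>z. 0 \<le> W z" "\<And>z. W z \<le> n"
    and sup: "circle_supermean (\<lambda>z. ennreal (W z))"
    and hol: "F holomorphic_on ball 0 1" and R: "0 < R" "R < 1"
  shows "0 \<le> (LINT z|lborel. indicator (ball 0 R) z *
      (W z * ((cmod (F z))\<^sup>2 + 2 * Re (z * deriv F z * cnj (F z)))))"
proof -
  obtain \<epsilon>0 K where eps0: "0 < \<epsilon>0" "R + \<epsilon>0 < 1"
    and est: "\<forall>\<epsilon> z. 0 < \<epsilon> \<longrightarrow> \<epsilon> < \<epsilon>0 \<longrightarrow> cmod z < R \<longrightarrow>
       (R\<^sup>2 - (cmod z)\<^sup>2) * (cmod (F z))\<^sup>2 - \<epsilon>\<^sup>2 * ((cmod (F z))\<^sup>2 + 2 * Re (z * deriv F z * cnj (F z))) - K * \<epsilon> ^ 3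
       \<le> (LINT w|circle_unif. (R\<^sup>2 - (cmod (z + \<epsilon> * w))\<^sup>2) * (cmod (F (z + \<epsilon> * w)))\<^sup>2)"
    using circle_mean_estimate[OF hol R] by (elim exE conjE) (rule that)
  define b where "b = (\<lambda>z. (R\<^sup>2 - (cmod z)\<^sup>2) * (cmod (F z))\<^sup>2)"
  \<comment> \<open>This is \<open>u + E u\<close> for \<open>u = |F|\<^sup>2\<close>.\<close>
  define v where "v = (\<lambda>z. (cmod (F z))\<^sup>2 + 2 * Re (z * deriv F z * cnj (F z)))"
  define h where "h = (\<lambda>z. indicator (ball 0 R) z * b z)"
  have cF: "continuous_on (ball 0 1) F" by (rule holomorphic_on_imp_continuous_on[OF hol])
  have cF': "continuous_on (ball 0 1) (deriv F)"
    by (intro holomorphic_on_imp_continuous_on holomorphic_deriv[OF hol]) auto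
  have cb: "continuous_on (ball 0 1) b" and cv: "continuous_on (ball 0 1) v"
    unfolding b_def v_def by (intro continuous_intros cF cF')+
  have hm [measurable]: "h \<in> borel_measurable borel"
    unfolding h_def by (rule borel_measurable_indicator_ball, rule continuous_on_subset[OF cb]) (use R in auto)
  have b_nonneg: "b z \<ge> 0" if "cmod z < R" for z
    using that by (auto simp: b_def power_mono intro!: mult_nonneg_nonneg)
  have b_nonpos: "b z \<le> 0" if "cmod z \<ge> R" for z
    using that R by (auto simp: b_def power_mono intro!: mult_nonpos_nonneg)
  define I where "I = (\<lambda>g. LINT z|lborel. indicator (ball 0 R) z * (W z * g z))"
  note int = integrable_ball_weight[OF Wm W _ R(2)]
  \<comment> \<open>Comparing \<open>b\<close> with its lower bound \<open>g\<close> for the means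
    gives \<open>I g \<le> I b\<close>, where the two sides differ by
    \<open>\<epsilon>\<^sup>2 * I v\<close> and a third-order error. Division by
    \<open>\<epsilon>\<^sup>2\<close> leaves an error linear in \<open>\<epsilon>\<close>, which
    vanishes in the limit.\<close>
  have key: "- (K * I (\<lambda>_. 1)) * \<epsilon> \<le> I v" if eps: "0 < \<epsilon>" "\<epsilon> < \<epsilon>0" for \<epsilon>
  proof -
    define g where "g = (\<lambda>z. b z - \<epsilon>\<^sup>2 * v z - K * \<epsilon> ^ 3)"
    have cg: "continuous_on (ball 0 1) g"
      unfolding g_def by (intro continuous_intros cb cv)
    have gle: "ennreal (g z) \<le> (\<integral>\<^sup>+w. ennreal (h (z + \<epsilon> * w)) \<partial>circle_unif)" if z: "cmod z < R" for z
    proof -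
      have ball: "z + \<epsilon> * w \<in> ball 0 1" if "w \<in> sphere 0 1" for w :: complex
        using norm_triangle_ineq[of z "\<epsilon> * w"] eps eps0 z that by (simp add: norm_mult)
      have "continuous_on (sphere 0 1) (\<lambda>w::complex. b (z + \<epsilon> * w))"
        by (rule continuous_on_compose2[OF cb]) (use ball in \<open>auto intro!: continuous_intros\<close>)
      note i = continuous_on_integrable_circle[OF this]
      have "ennreal (g z) \<le> ennreal (LINT w|circle_unif. b (z + \<epsilon> * w))"
        using est[rule_format, OF eps z] by (intro ennreal_leI) (simp add: g_def b_def v_def)
      also have "\<dots> \<le> (\<integral>\<^sup>+w. ennreal (b (z + \<epsilon> * w)) \<partial>circle_unif)"
        by (rule ennreal_integral_le_nn_integral[OF i])
      also have "\<dots> \<le> (\<integral>\<^sup>+w. ennreal (h (z + \<epsilon> * w)) \<partial>circle_unif)"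
        by (intro nn_integral_mono ennreal_leI) (auto simp: h_def indicator_def b_nonpos)
      finally show ?thesis .
    qed
    have "ennreal (I g) \<le> (\<integral>\<^sup>+z. ennreal (indicator (ball 0 R) z * (W z * g z)) \<partial>lborel)"
      unfolding I_def by (rule ennreal_integral_le_nn_integral[OF int[OF cg]])
    also have "\<dots> \<le> (\<integral>\<^sup>+z. ennreal (W z) * (\<integral>\<^sup>+w. ennreal (h (z + \<epsilon> * w)) \<partial>circle_unif) \<partial>lborel)"
      by (intro nn_integral_mono)
         (auto simp: indicator_def ennreal_mult' W intro!: mult_left_mono gle)
    also have "\<dots> = (\<integral>\<^sup>+z. ennreal (h z) * (\<integral>\<^sup>+w. ennreal (W (z + - complex_of_real \<epsilon> * w)) \<partial>circle_unif) \<partial>lborel)"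
      by (rule circle_average_selfadjoint) auto
    \<comment> \<open>\<open>h\<close> vanishes for \<open>|z| \<ge> R\<close>, so the super-mean
      property is invoked only where \<open>R + \<epsilon>0 < 1\<close> keeps the circle inside the
      unit disk.\<close>
    also have "\<dots> \<le> (\<integral>\<^sup>+z. ennreal (h z) * ennreal (W z) \<partial>lborel)"
    proof (rule nn_integral_mono)
      fix z
      show "ennreal (h z) * (\<integral>\<^sup>+w. ennreal (W (z + - complex_of_real \<epsilon> * w)) \<partial>circle_unif) \<le> ennreal (h z) * ennreal (W z)"
      proof (cases "cmod z < R")
        case True
        then have "(\<integral>\<^sup>+w. ennreal (W (z + - complex_of_real \<epsilon> * w)) \<partial>circle_unif) \<le> ennreal (W z)"
          using sup[unfolded circle_supermean_def, rule_format, of z "- complex_of_real \<epsilon>"] eps eps0 by simp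
        then show ?thesis by (rule mult_left_mono) simp
      qed (simp add: h_def)
    qed
    also have "\<dots> = (\<integral>\<^sup>+z. ennreal (indicator (ball 0 R) z * (W z * b z)) \<partial>lborel)"
      by (intro nn_integral_cong) (auto simp: h_def indicator_def ennreal_mult' W mult_ac)
    also have "\<dots> = ennreal (I b)"
      unfolding I_def
      by (rule nn_integral_eq_integral[OF int[OF cb]]) (auto simp: indicator_def W b_nonneg)
    \<comment> \<open>\<open>I g\<close> may be negative and is then truncated by
      \<open>ennreal\<close>; the comparison survives because \<open>I b\<close> is
      nonnegative.\<close>
    finally have "I g \<le> I b"
      by (subst (asm) ennreal_le_iff) (auto simp: I_def indicator_def W b_nonneg intro!: integral_nonneg_AE)
    moreover have "I g = I b - \<epsilon>\<^sup>2 * I v - K * \<epsilon> ^ 3 * I (\<lambda>_. 1)"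
    proof -
      have "I g = (LINT z|lborel. indicator (ball 0 R) z * (W z * b z)
          - \<epsilon>\<^sup>2 * (indicator (ball 0 R) z * (W z * v z)) - K * \<epsilon> ^ 3 * (indicator (ball 0 R) z * (W z * 1)))"
        unfolding I_def g_def by (intro Bochner_Integration.integral_cong) (auto simp: algebra_simps)
      then show ?thesis
        unfolding I_def using int[OF cb] int[OF cv] int[of "\<lambda>_. 1"] by simp
    qed
    ultimately have "\<epsilon>\<^sup>2 * (- (K * I (\<lambda>_. 1)) * \<epsilon>) \<le> \<epsilon>\<^sup>2 * I v"
      by (simp add: power2_eq_square power3_eq_cube algebra_simps)
    then show ?thesis by (rule mult_left_le_imp_le) (use eps in simp)
  qed
  have "0 \<le> I v"
  proof (rule tendsto_upperbound)
    show "((\<lambda>\<epsilon>. - (K * I (\<lambda>_. 1)) * \<epsilon>) \<longlongrightarrow> 0) (at_right 0)"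
      by (auto intro!: tendsto_eq_intros)
    show "\<forall>\<^sub>F \<epsilon> in at_right 0. - (K * I (\<lambda>_. 1)) * \<epsilon> \<le> I v"
      using eventually_at_right_less[of 0] eventually_at_right_field eps0 key
      by (auto simp: eventually_at_right_field)
  qed simp
  then show ?thesis unfolding I_def v_def .
qed

section \<open>Dilations, and integration over the dilation parameter\<close>

lemma of_real_mult_in_unit_ball:
  fixes z :: complex
  assumes "t \<in> {0..1}" "z \<in> ball 0 1"
  shows "of_real t * z \<in> ball 0 1"
  using assms mult_left_le_one_le[of "cmod z" t] by (auto simp: norm_mult)

lemma holomorphic_on_dilation:
  assumes "f holomorphic_on ball 0 1" "t \<in> {0..1}"
  shows "(\<lambda>z. f (of_real t * z)) holomorphic_on ball 0 1"
  by (rule holomorphic_on_compose_gen[OF _ assms(1), unfolded o_def])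
     (use of_real_mult_in_unit_ball[OF assms(2)] in \<open>auto intro!: holomorphic_intros\<close>)

lemma deriv_dilation:
  assumes "f holomorphic_on ball 0 1" "t \<in> {0..1}" "z \<in> ball 0 1"
  shows "deriv (\<lambda>z. f (of_real t * z)) z = of_real t * deriv f (of_real t * z)"
proof -
  have "(f has_field_derivative deriv f (of_real t * z)) (at (of_real t * z))"
    using of_real_mult_in_unit_ball[OF assms(2,3)] by (intro holomorphic_derivI[OF assms(1)]) auto
  then have "((\<lambda>z. f (of_real t * z)) has_field_derivative deriv f (of_real t * z) * of_real t) (at z)"
    by (rule DERIV_chain2) (auto intro!: derivative_eq_intros)
  then show ?thesis by (simp add: DERIV_imp_deriv mult.commute)
qed

lemma supermean_weight_dilation_bounded:
  fixes W :: "complex \<Rightarrow> real"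
  assumes Wm [measurable]: "W \<in> borel_measurable borel" and W: "\<And>z. 0 \<le> W z" "\<And>z. W z \<le> n"
    and sup: "circle_supermean (\<lambda>z. ennreal (W z))"
    and hol: "F holomorphic_on ball 0 1" and R: "0 < R" "R < 1" and r: "0 \<le> r" "r \<le> 1"
  shows "(LINT z|lborel. indicator (ball 0 R) z * (W z * (r * (cmod (F (of_real r * z)))\<^sup>2)))
    \<le> (LINT z|lborel. indicator (ball 0 R) z * (W z * (cmod (F z))\<^sup>2))"
proof -
  \<comment> \<open>\<open>v t\<close> is \<open>u + E u\<close> for the dilate
    \<open>F (t * z)\<close>, which gives its weighted integral a sign, and it is also the
    \<open>t\<close>-derivative of \<open>t * |F (t * z)|\<^sup>2\<close>, which makes it integrable
    in closed form.\<close>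
  define v where "v = (\<lambda>t z. (cmod (F (of_real t * z)))\<^sup>2
      + 2 * Re (z * (of_real t * deriv F (of_real t * z)) * cnj (F (of_real t * z))))"
  define G where "G = (\<lambda>(z, t). indicator (ball 0 R \<times> {r..1}) (z, t) * (W z * v t z))"
  have cF: "continuous_on (ball 0 1) F" by (rule holomorphic_on_imp_continuous_on[OF hol])
  have cF': "continuous_on (ball 0 1) (deriv F)"
    by (intro holomorphic_on_imp_continuous_on holomorphic_deriv[OF hol]) auto
  note tz = of_real_mult_in_unit_ball
  have FT: "continuous_on ({0..1} \<times> ball 0 1) (\<lambda>x. F (of_real (fst x) * snd x))"
    by (rule continuous_on_compose2[OF cF]) (use tz in \<open>auto intro!: continuous_intros\<close>)
  have FT': "continuous_on ({0..1} \<times> ball 0 1) (\<lambda>x. deriv F (of_real (fst x) * snd x))"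
    by (rule continuous_on_compose2[OF cF']) (use tz in \<open>auto intro!: continuous_intros\<close>)
  have cv: "continuous_on ({0..1} \<times> ball 0 1) (\<lambda>x. v (fst x) (snd x))"
    unfolding v_def by (intro continuous_intros FT FT')
  have cv_swap: "continuous_on (ball 0 1 \<times> {0..1}) (\<lambda>x. v (snd x) (fst x))"
  proof -
    have "continuous_on (ball 0 1 \<times> {0..1}) (prod.swap :: complex \<times> real \<Rightarrow> real \<times> complex)"
      unfolding prod.swap_def by (intro continuous_intros)
    moreover have "prod.swap ` (ball 0 1 \<times> {0..1}) \<subseteq> {0..1::real} \<times> ball (0::complex) 1"
      by auto
    ultimately have "continuous_on (ball 0 1 \<times> {0..1}) (\<lambda>x. v (fst (prod.swap x)) (snd (prod.swap x)))"
      by (rule continuous_on_compose2[OF cv])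
    then show ?thesis by simp
  qed
  have cv_t: "continuous_on {r..1} (\<lambda>t. v t z)" if "z \<in> ball 0 1" for z
  proof -
    have "continuous_on {r..1} (\<lambda>t. v (fst (t, z)) (snd (t, z)))"
      by (rule continuous_on_compose2[OF cv]) (use that r in \<open>auto intro!: continuous_intros\<close>)
    then show ?thesis by simp
  qed
  have nonneg: "0 \<le> (LINT z|lborel. indicator (ball 0 R) z * (W z * v t z))" if t: "t \<in> {0..1}" for t
  proof -
    note hol_t = holomorphic_on_dilation[OF hol t]
    have "0 \<le> (LINT z|lborel. indicator (ball 0 R) z * (W z * ((cmod (F (of_real t * z)))\<^sup>2
        + 2 * Re (z * deriv (\<lambda>z. F (of_real t * z)) z * cnj (F (of_real t * z))))))"
      by (rule supermean_weight_integral_nonneg[OF Wm W sup hol_t R])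
    also have "\<dots> = (LINT z|lborel. indicator (ball 0 R) z * (W z * v t z))"
    proof (intro Bochner_Integration.integral_cong refl)
      fix z :: complex
      have "deriv (\<lambda>z. F (of_real t * z)) z = of_real t * deriv F (of_real t * z)" if "z \<in> ball 0 R"
        using that R by (intro deriv_dilation[OF hol t]) auto
      then show "indicator (ball 0 R) z * (W z * ((cmod (F (of_real t * z)))\<^sup>2
        + 2 * Re (z * deriv (\<lambda>z. F (of_real t * z)) z * cnj (F (of_real t * z)))))
        = indicator (ball 0 R) z * (W z * v t z)"
        by (cases "z \<in> ball 0 R") (simp_all add: v_def)
    qed
    finally show ?thesis .
  qed
  have G_int: "integrable lborel G"
  proof -
    let ?A = "ball (0::complex) R \<times> {r..1}"
    have A: "?A \<in> sets borel" by (simp add: borel_Times)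
    have sub: "cball (0::complex) R \<times> {r..1} \<subseteq> ball 0 1 \<times> {0..1}" using R r by auto
    have [measurable]: "(\<lambda>x. indicator ?A x * v (snd x) (fst x)) \<in> borel_measurable borel"
      using borel_measurable_continuous_on_indicator[OF A continuous_on_subset[OF cv_swap]] R r
      by fastforce
    have "bounded ((\<lambda>x. v (snd x) (fst x)) ` (cball 0 R \<times> {r..1}))"
      by (intro compact_imp_bounded compact_continuous_image continuous_on_subset[OF cv_swap sub] compact_Times) auto
    then obtain B where B: "\<And>x. x \<in> cball 0 R \<times> {r..1} \<Longrightarrow> \<bar>v (snd x) (fst x)\<bar> \<le> B"
      unfolding bounded_iff real_norm_def by blast
    have [measurable]: "(\<lambda>x. W (fst x)) \<in> borel_measurable (borel :: (complex \<times> real) measure)"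
      by (intro measurable_compose[OF _ Wm] borel_measurable_continuous_onI continuous_intros)
    have "integrable lborel (\<lambda>x. W (fst x) * (indicator ?A x * v (snd x) (fst x)))"
    proof (rule integrableI_bounded_set[where A = ?A and B = "n * B"])
      show "?A \<in> sets lborel" using A by simp
      show "emeasure lborel ?A < \<infinity>"
        by (intro emeasure_bounded_finite bounded_Times) auto
      show "AE x in lborel. x \<in> ?A \<longrightarrow> norm (W (fst x) * (indicator ?A x * v (snd x) (fst x))) \<le> n * B"
      proof (intro AE_I2 impI)
        fix x :: "complex \<times> real" assume x: "x \<in> ?A"
        then have "\<bar>v (snd x) (fst x)\<bar> \<le> B" using B[of x] by auto
        then show "norm (W (fst x) * (indicator ?A x * v (snd x) (fst x))) \<le> n * B"
          using W[of "fst x"] x by (auto simp: abs_mult intro!: mult_mono)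
      qed
    qed auto
    then show ?thesis by (simp add: G_def case_prod_unfold mult_ac)
  qed
  \<comment> \<open>The fundamental theorem of calculus in \<open>t\<close> at fixed
    \<open>z\<close>; the end points 1 and \<open>r\<close> yield the two integrands to be
    compared.\<close>
  have inner: "(LINT t|lborel. G (z, t)) = indicator (ball 0 R) z * (W z * ((cmod (F z))\<^sup>2 - r * (cmod (F (of_real r * z)))\<^sup>2))" for z
  proof (cases "z \<in> ball 0 R")
    case True
    then have z: "z \<in> ball 0 1" using R by auto
    have "(LINT t|lborel. indicator {r..1} t *\<^sub>R v t z)
      = 1 * (cmod (F (of_real 1 * z)))\<^sup>2 - r * (cmod (F (of_real r * z)))\<^sup>2"
    proof (rule integral_FTC_atLeastAtMost[OF r(2) _ cv_t[OF z]])
      fix t assume t: "r \<le> t" "t \<le> 1"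
      have "((\<lambda>t. F (of_real t * z)) has_vector_derivative (z * deriv F (of_real t * z))) (at t within {r..1})"
      proof -
        have dF: "(F has_field_derivative deriv F (of_real t * z)) (at (of_real t * z))"
          using tz[of t z] t z r by (intro holomorphic_derivI[OF hol]) auto
        have dt: "((\<lambda>t. of_real t * z) has_vector_derivative z) (at t within {r..1})"
          by (auto simp: has_vector_derivative_def scaleR_conv_of_real[symmetric] intro!: derivative_eq_intros)
        have "((F \<circ> (\<lambda>t. of_real t * z)) has_vector_derivative z * deriv F (of_real t * z)) (at t within {r..1})"
          by (rule field_vector_diff_chain_within[OF dt has_field_derivative_at_within[OF dF]])
        then show ?thesis by (simp add: o_def)
      qed
      then have "((\<lambda>t. F (of_real t * z)) has_derivative (\<lambda>h. h *\<^sub>R (z * deriv F (of_real t * z)))) (at t within {r..1})"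
        by (simp add: has_vector_derivative_def)
      note D = this
      have "((\<lambda>t. t * (F (of_real t * z) \<bullet> F (of_real t * z))) has_derivative
          (\<lambda>h. t * (F (of_real t * z) \<bullet> (h *\<^sub>R (z * deriv F (of_real t * z))) + (h *\<^sub>R (z * deriv F (of_real t * z))) \<bullet> F (of_real t * z))
            + h * (F (of_real t * z) \<bullet> F (of_real t * z)))) (at t within {r..1})"
        by (intro has_derivative_mult has_derivative_inner D has_derivative_ident)
      then have "((\<lambda>t. t * (F (of_real t * z) \<bullet> F (of_real t * z))) has_derivative (\<lambda>h. h *\<^sub>R v t z)) (at t within {r..1})"
        by (rule has_derivative_eq_rhs)
           (auto simp: v_def fun_eq_iff power2_norm_eq_inner inner_complex_def algebra_simps)
      then show "((\<lambda>t. t * (cmod (F (of_real t * z)))\<^sup>2) has_vector_derivative v t z) (at t within {r..1})"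
        by (simp add: has_vector_derivative_def power2_norm_eq_inner)
    qed
    then have "(LINT t|lborel. indicator {r..1} t * v t z) = (cmod (F z))\<^sup>2 - r * (cmod (F (of_real r * z)))\<^sup>2"
      by simp
    moreover have "(LINT t|lborel. G (z, t)) = W z * (LINT t|lborel. indicator {r..1} t * v t z)"
      using True by (subst Bochner_Integration.integral_mult_right_zero[symmetric])
        (auto simp: G_def indicator_times mult_ac intro!: Bochner_Integration.integral_cong)
    ultimately show ?thesis using True by simp
  qed (simp add: G_def indicator_times)
  \<comment> \<open>Integrating over \<open>z\<close> first gives a nonnegative function of
    \<open>t\<close>: for \<open>t\<close> in \<open>{r..1}\<close> by the result for dilates,
    elsewhere because \<open>G\<close> is zero. Fubini's theorem then allows the order used in
    \<open>inner\<close>.\<close>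
  have "0 \<le> (LINT t|lborel. LINT z|lborel. G (z, t))"
  proof (rule integral_nonneg_AE, rule AE_I2)
    fix t
    show "0 \<le> (LINT z|lborel. G (z, t))"
    proof (cases "t \<in> {r..1}")
      case True
      then show ?thesis using nonneg[of t] r by (simp add: G_def indicator_times)
    qed (simp add: G_def indicator_times)
  qed
  also have "\<dots> = (LINT z|lborel. LINT t|lborel. G (z, t))"
    using lborel_pair.Fubini_integral[of "\<lambda>z t. G (z, t)"] G_int by (simp add: lborel_prod)
  also have "\<dots> = (LINT z|lborel. indicator (ball 0 R) z * (W z * (cmod (F z))\<^sup>2)
      - indicator (ball 0 R) z * (W z * (r * (cmod (F (of_real r * z)))\<^sup>2)))"
    unfolding inner by (simp add: algebra_simps)
  also have "\<dots> = (LINT z|lborel. indicator (ball 0 R) z * (W z * (cmod (F z))\<^sup>2))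
      - (LINT z|lborel. indicator (ball 0 R) z * (W z * (r * (cmod (F (of_real r * z)))\<^sup>2)))"
  proof (rule Bochner_Integration.integral_diff; rule integrable_ball_weight[OF Wm W _ R(2)])
    have "continuous_on (ball 0 1) (\<lambda>z. F (of_real r * z))"
      using r by (intro holomorphic_on_imp_continuous_on holomorphic_on_dilation[OF hol]) auto
    then show "continuous_on (ball 0 1) (\<lambda>z. r * (cmod (F (of_real r * z)))\<^sup>2)"
      by (intro continuous_intros)
    show "continuous_on (ball 0 1) (\<lambda>z. (cmod (F z))\<^sup>2)"
      by (intro continuous_intros cF)
  qed
  finally show ?thesis by simp
qed

section \<open>Circular means of the logarithmic and Poisson kernels\<close>

text \<open>After division by \<open>a\<close> the integrand is the real part of
  \<open>Ln (1 + b / a * w)\<close>, which is holomorphic on a disk of radius greater than 1 because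
  the zero of \<open>a + b * w\<close> lies outside the closed unit disk.\<close>

lemma circle_mean_ln_norm:
  fixes a b :: complex
  assumes "cmod b < cmod a"
  shows "(LINT w|circle_unif. ln (cmod (a + b * w))) = ln (cmod a)"
proof -
  have a: "a \<noteq> 0" using assms by auto
  \<comment> \<open>With \<open>s = |a| / |b|\<close> the number \<open>b / a * w\<close> stays in
    the unit disk for \<open>|w| < s\<close>, which keeps \<open>1 + b / a * w\<close> off the
    branch cut.\<close>
  have "\<exists>s>1. cmod (b / a) * s \<le> 1"
  proof (cases "b = 0")
    case False
    then show ?thesis using assms a
      by (intro exI[of _ "cmod a / cmod b"]) (auto simp: norm_divide field_simps)
  qed (auto intro: exI[of _ 2])
  then obtain s where s: "s > 1" "cmod (b / a) * s \<le> 1" by blast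
  have pos: "1 + b / a * w \<notin> \<real>\<^sub>\<le>\<^sub>0" if "w \<in> ball 0 s" for w
  proof -
    have "cmod (b / a * w) < 1"
    proof (cases "b = 0")
      case False
      then have "cmod (b / a) * cmod w < cmod (b / a) * s"
        using that a by (intro mult_strict_left_mono) auto
      then show ?thesis using s by (simp only: norm_mult)
    qed auto
    then have "\<bar>Re (b / a * w)\<bar> < 1" using abs_Re_le_cmod le_less_trans by blast
    then show ?thesis by (auto simp: complex_nonpos_Reals_iff)
  qed
  have hol: "(\<lambda>w. Ln (1 + b / a * w)) holomorphic_on ball 0 s"
    using pos by (intro holomorphic_intros) auto
  have "(LINT w|circle_unif. ln (cmod (a + b * w))) = (LINT w|circle_unif. ln (cmod a) + Re (Ln (1 + b / a * w)))"
  proof (intro Bochner_Integration.integral_cong refl)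
    fix w assume "w \<in> space circle_unif"
    then have "1 + b / a * w \<noteq> 0" using pos[of w] s by auto
    moreover have "a + b * w = a * (1 + b / a * w)" using a by (simp add: algebra_simps)
    ultimately show "ln (cmod (a + b * w)) = ln (cmod a) + Re (Ln (1 + b / a * w))"
      using a by (simp only: norm_mult Re_Ln) (simp add: ln_mult)
  qed
  also have "\<dots> = ln (cmod a) + (LINT w|circle_unif. Re (Ln (1 + b / a * w)))"
  proof -
    have "continuous_on (sphere 0 1) (\<lambda>w. Ln (1 + b / a * w))"
      by (rule continuous_on_subset[OF holomorphic_on_imp_continuous_on[OF hol]]) (use s in auto)
    then have "integrable circle_unif (\<lambda>w. Re (Ln (1 + b / a * w)))"
      by (intro continuous_on_integrable_circle continuous_on_Re)
    then show ?thesis by simp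
  qed
  also have "(LINT w|circle_unif. Re (Ln (1 + b / a * w))) = 0"
    using circle_mean_value_Re[OF hol s(1)] by simp
  finally show ?thesis by simp
qed

text \<open>An instance of Jensen's formula. If the zero lies inside the circle, conjugating and
  using \<open>w * cnj w = 1\<close> exchanges the roles of \<open>a\<close> and \<open>b\<close>,
  so the mean is \<open>ln (cmod b)\<close>, the larger of the two logarithms.\<close>

lemma circle_mean_ln_norm_ge:
  fixes a b :: complex
  assumes "a \<noteq> 0" "cmod a \<noteq> cmod b"
  shows "ln (cmod a) \<le> (LINT w|circle_unif. ln (cmod (a + b * w)))"
proof (cases "cmod b < cmod a")
  case False
  then have ab: "cmod a < cmod b" using assms by simp
  have "(LINT w|circle_unif. ln (cmod (a + b * w))) = (LINT w|circle_unif. ln (cmod (cnj b + cnj a * w)))"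
  proof (intro Bochner_Integration.integral_cong refl arg_cong[where f = ln])
    fix w assume "w \<in> space circle_unif"
    then have w: "cmod w = 1" by simp
    then have "w * cnj w = 1" by (simp add: complex_norm_square[symmetric])
    then have "a + b * w = w * cnj (cnj b + cnj a * w)"
      by (simp add: algebra_simps)
    then have "cmod (a + b * w) = cmod w * cmod (cnj b + cnj a * w)"
      by (simp only: norm_mult complex_mod_cnj)
    then show "cmod (a + b * w) = cmod (cnj b + cnj a * w)"
      using w by simp
  qed
  also have "\<dots> = ln (cmod b)" using circle_mean_ln_norm[of "cnj a" "cnj b"] ab by simp
  finally show ?thesis using ab assms by (simp add: ln_mono)
qed (simp add: circle_mean_ln_norm)

text \<open>Ensures that the logarithm in \<open>log_kernel\<close> is nonnegative on the disk, so
  that its conversion to \<open>ennreal\<close> loses nothing.\<close>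

lemma norm_diff_le_norm_one_minus_cnj_mult:
  assumes "cmod \<zeta> < 1" "cmod z < 1"
  shows "cmod (\<zeta> - z) \<le> cmod (1 - cnj \<zeta> * z)"
proof -
  have "(cmod (1 - cnj \<zeta> * z))\<^sup>2 - (cmod (\<zeta> - z))\<^sup>2 = (1 - (cmod \<zeta>)\<^sup>2) * (1 - (cmod z)\<^sup>2)"
    by (simp only: cmod_power2) (simp add: power2_eq_square algebra_simps)
  also have "\<dots> \<ge> 0"
    using assms by (intro mult_nonneg_nonneg) (auto simp: power_le_one)
  finally have "(cmod (\<zeta> - z))\<^sup>2 \<le> (cmod (1 - cnj \<zeta> * z))\<^sup>2" by simp
  then show ?thesis by (rule power2_le_imp_le) simp
qed

lemma one_minus_cnj_mult_nonzero:
  assumes "cmod \<zeta> < 1" "cmod z < 1"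
  shows "1 - cnj \<zeta> * z \<noteq> 0"
proof
  assume "1 - cnj \<zeta> * z = 0"
  then have "cmod (cnj \<zeta> * z) = 1" by simp
  moreover have "cmod \<zeta> * cmod z < 1 * 1" using assms by (intro mult_strict_mono) auto
  ultimately show False by (simp add: norm_mult)
qed

text \<open>Continuity is meant in \<open>ennreal\<close> and includes the pole, where the quotient
  tends to infinity in agreement with the value assigned there. The limit of shrunken circles
  through the pole relies on this.\<close>

lemma isCont_log_kernel:
  assumes \<zeta>: "cmod \<zeta> < 1" and u: "cmod u < 1"
  shows "isCont (\<lambda>z. log_kernel z \<zeta>) u"
proof (cases "u = \<zeta>")
  case True
  have "filterlim (\<lambda>z. (1 - cnj \<zeta> * z) / (\<zeta> - z)) at_infinity (at \<zeta>)"
  proof (rule filterlim_divide_at_infinity)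
    show "((\<lambda>z. 1 - cnj \<zeta> * z) \<longlongrightarrow> 1 - cnj \<zeta> * \<zeta>) (at \<zeta>)" by (intro tendsto_intros)
    show "1 - cnj \<zeta> * \<zeta> \<noteq> 0" by (rule one_minus_cnj_mult_nonzero[OF \<zeta> \<zeta>])
    have "((\<lambda>z. \<zeta> - z) \<longlongrightarrow> \<zeta> - \<zeta>) (at \<zeta>)" by (intro tendsto_intros)
    then show "filterlim (\<lambda>z. \<zeta> - z) (at 0) (at \<zeta>)"
      by (auto simp: filterlim_at eventually_at_filter)
  qed
  then have "filterlim (\<lambda>z. ln (cmod ((1 - cnj \<zeta> * z) / (\<zeta> - z)))) at_top (at \<zeta>)"
    by (intro filterlim_compose[OF ln_at_top] filterlim_at_infinity_imp_norm_at_top)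
  then have "((\<lambda>z. ennreal (ln (cmod ((1 - cnj \<zeta> * z) / (\<zeta> - z))))) \<longlongrightarrow> top) (at \<zeta>)"
    by (simp add: ennreal_tendsto_top_eq_at_top)
  then have "((\<lambda>z. log_kernel z \<zeta>) \<longlongrightarrow> top) (at \<zeta>)"
    by (rule Lim_transform_eventually) (auto simp: log_kernel_def eventually_at_filter)
  then show ?thesis using True by (simp add: isCont_def log_kernel_def)
next
  case False
  have "((\<lambda>z. ennreal (ln (cmod ((1 - cnj \<zeta> * z) / (\<zeta> - z))))) \<longlongrightarrow>
      ennreal (ln (cmod ((1 - cnj \<zeta> * u) / (\<zeta> - u))))) (at u)"
    using False one_minus_cnj_mult_nonzero[OF \<zeta> u] by (intro tendsto_ennrealI tendsto_intros) auto
  moreover have "\<forall>\<^sub>F z in at u. ennreal (ln (cmod ((1 - cnj \<zeta> * z) / (\<zeta> - z)))) = log_kernel z \<zeta>"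
    using t1_space_nhds[OF False] False
    by (auto simp: log_kernel_def eventually_at_filter elim: eventually_mono)
  ultimately show ?thesis
    using False unfolding isCont_def by (auto simp: log_kernel_def intro: Lim_transform_eventually)
qed

text \<open>The kernel is a difference \<open>g - l\<close> of logarithms of moduli of affine
  functions of \<open>w\<close>. The one in \<open>g\<close> has no zero in the closed disk, so its
  mean is the central value; the mean of \<open>l\<close> can only exceed its central value. The
  hypothesis \<open>ne\<close> keeps the pole off the circle, where both logarithms are then
  continuous. If \<open>z\<close> is the pole itself, the bound is infinite.\<close>

lemma log_kernel_supermean_generic:
  assumes \<zeta>: "cmod \<zeta> < 1" and z: "cmod z + cmod c < 1" and ne: "cmod (z - \<zeta>) \<noteq> cmod c"
  shows "(\<integral>\<^sup>+w. log_kernel (z + c * w) \<zeta> \<partial>circle_unif) \<le> log_kernel z \<zeta>"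
proof (cases "z = \<zeta>")
  case False
  have z1: "cmod z < 1" using z norm_ge_zero[of c] by linarith
  have in_disk: "cmod (z + c * w) < 1" if "cmod w = 1" for w
    using norm_triangle_ineq[of z "c * w"] that z by (simp add: norm_mult)
  have off: "z + c * w \<noteq> \<zeta>" if "cmod w = 1" for w
  proof
    assume "z + c * w = \<zeta>"
    then have "z - \<zeta> = - (c * w)" by (simp add: algebra_simps)
    then have "cmod (z - \<zeta>) = cmod (c * w)" by simp
    then show False using ne that by (simp add: norm_mult)
  qed
  define g where "g = (\<lambda>w. ln (cmod ((1 - cnj \<zeta> * z) + (- cnj \<zeta> * c) * w)))"
  define l where "l = (\<lambda>w. ln (cmod ((z - \<zeta>) + c * w)))"
  have g_alt: "(1 - cnj \<zeta> * z) + (- cnj \<zeta> * c) * w = 1 - cnj \<zeta> * (z + c * w)" for w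
    by (simp add: algebra_simps)
  have kernel: "log_kernel (z + c * w) \<zeta> = ennreal (g w - l w)" "l w \<le> g w"
    if "cmod w = 1" for w
  proof -
    have "(z - \<zeta>) + c * w = - (\<zeta> - (z + c * w))" by simp
    then have l_eq: "l w = ln (cmod (\<zeta> - (z + c * w)))"
      unfolding l_def by (simp only: norm_minus_cancel)
    have pos: "cmod (1 - cnj \<zeta> * (z + c * w)) > 0" "cmod (\<zeta> - (z + c * w)) > 0"
      using one_minus_cnj_mult_nonzero[OF \<zeta> in_disk[OF that]] off[OF that] by auto
    show "log_kernel (z + c * w) \<zeta> = ennreal (g w - l w)"
      using off[OF that] pos unfolding log_kernel_def l_eq g_def g_alt
      by (simp add: norm_divide ln_div)
    show "l w \<le> g w"
      unfolding l_eq g_def g_alt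
      using norm_diff_le_norm_one_minus_cnj_mult[OF \<zeta> in_disk[OF that]] pos by simp
  qed
  have "continuous_on (sphere 0 1) g"
    unfolding g_def g_alt using one_minus_cnj_mult_nonzero[OF \<zeta> in_disk]
    by (intro continuous_intros) auto
  note ig = continuous_on_integrable_circle[OF this]
  have "continuous_on (sphere 0 1) l"
    unfolding l_def using off by (intro continuous_intros) (auto simp: algebra_simps)
  note il = continuous_on_integrable_circle[OF this]
  have "(\<integral>\<^sup>+w. log_kernel (z + c * w) \<zeta> \<partial>circle_unif) = (\<integral>\<^sup>+w. ennreal (g w - l w) \<partial>circle_unif)"
    by (intro nn_integral_cong) (simp add: kernel)
  also have "\<dots> = ennreal ((LINT w|circle_unif. g w) - (LINT w|circle_unif. l w))"
    using ig il by (subst nn_integral_eq_integral) (auto simp: kernel)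
  also have "\<dots> \<le> ennreal (ln (cmod (1 - cnj \<zeta> * z)) - ln (cmod (z - \<zeta>)))"
  proof (intro ennreal_leI diff_mono)
    \<comment> \<open>The inequality \<open>|b| < |a|\<close> needed for the exact mean of
      \<open>g\<close> follows since \<open>|\<zeta>| (|z| + |c|) < 1\<close>.\<close>
    have "cmod \<zeta> * (cmod z + cmod c) \<le> 1 * (cmod z + cmod c)"
      using \<zeta> by (intro mult_right_mono) auto
    then have "cmod (cnj \<zeta> * z) + cmod (- cnj \<zeta> * c) < 1"
      using z by (simp add: norm_mult algebra_simps)
    then have "cmod (- cnj \<zeta> * c) < cmod (1 - cnj \<zeta> * z)"
      using norm_triangle_ineq2[of 1 "cnj \<zeta> * z"] by simp
    then show "(LINT w|circle_unif. g w) \<le> ln (cmod (1 - cnj \<zeta> * z))"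
      unfolding g_def by (simp only: circle_mean_ln_norm)
    show "ln (cmod (z - \<zeta>)) \<le> (LINT w|circle_unif. l w)"
      unfolding l_def using False ne by (intro circle_mean_ln_norm_ge) auto
  qed
  also have "\<dots> = log_kernel z \<zeta>"
    using False one_minus_cnj_mult_nonzero[OF \<zeta> z1]
    by (simp add: log_kernel_def norm_divide ln_div norm_minus_commute)
  finally show ?thesis .
qed (simp add: log_kernel_def)

text \<open>
  When the circle passes through the pole \<open>\<zeta>\<close> the kernel is unbounded on it, and the estimate
  comes from smaller concentric circles by Fatou's lemma.
\<close>

lemma log_kernel_supermean:
  assumes \<zeta>: "cmod \<zeta> < 1" and z: "cmod z + cmod c < 1"
  shows "(\<integral>\<^sup>+w. log_kernel (z + c * w) \<zeta> \<partial>circle_unif) \<le> log_kernel z \<zeta>"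
proof (cases "z = \<zeta> \<or> cmod (z - \<zeta>) \<noteq> cmod c")
  case True
  then show ?thesis
    using log_kernel_supermean_generic[OF \<zeta> z] by (auto simp: log_kernel_def)
next
  case False
  then have c: "c \<noteq> 0" and ac: "cmod (z - \<zeta>) = cmod c" by auto
  \<comment> \<open>Factors in \<open>[0, 1)\<close> tending to 1. The circles of radius
    \<open>s k * |c|\<close> miss the pole, which sits at distance exactly \<open>|c|\<close> from
    \<open>z\<close>.\<close>
  define s :: "nat \<Rightarrow> real" where "s k = 1 - inverse (real (Suc k))" for k
  have s: "0 \<le> s k" "s k < 1" for k by (auto simp: s_def field_simps)
  have s_lim: "s \<longlonglongrightarrow> 1"
    unfolding s_def using LIMSEQ_inverse_real_of_nat_add_minus[of 1] by simp
  have sk: "cmod z + cmod (s k * c) < 1" for k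
    using z s[of k] mult_left_le_one_le[of "cmod c" "s k"] by (simp add: norm_mult)
  have cont: "continuous_on (sphere 0 1) (\<lambda>w. log_kernel (z + d * w) \<zeta>)" if d: "cmod z + cmod d < 1" for d
  proof (intro continuous_at_imp_continuous_on ballI)
    fix w :: complex assume "w \<in> sphere 0 1"
    then have "cmod (z + d * w) < 1"
      using norm_triangle_ineq[of z "d * w"] d by (simp add: norm_mult)
    then show "isCont (\<lambda>w. log_kernel (z + d * w) \<zeta>) w"
      by (intro isCont_o2[OF _ isCont_log_kernel[OF \<zeta>]] continuous_intros)
  qed
  have lim: "(\<lambda>k. log_kernel (z + s k * c * w) \<zeta>) \<longlonglongrightarrow> log_kernel (z + c * w) \<zeta>" if "cmod w = 1" for w
  proof -
    have "cmod (z + c * w) < 1"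
      using norm_triangle_ineq[of z "c * w"] that z by (simp add: norm_mult)
    moreover have "(\<lambda>k. z + s k * c * w) \<longlonglongrightarrow> z + of_real 1 * c * w"
      by (intro tendsto_intros s_lim)
    ultimately show ?thesis
      by (intro isCont_tendsto_compose[OF isCont_log_kernel[OF \<zeta>]]) auto
  qed
  have "(\<integral>\<^sup>+w. log_kernel (z + c * w) \<zeta> \<partial>circle_unif)
      = (\<integral>\<^sup>+w. liminf (\<lambda>k. log_kernel (z + s k * c * w) \<zeta>) \<partial>circle_unif)"
  proof (rule nn_integral_cong)
    fix w assume "w \<in> space circle_unif"
    then show "log_kernel (z + c * w) \<zeta> = liminf (\<lambda>k. log_kernel (z + s k * c * w) \<zeta>)"
      using lim_imp_Liminf[OF _ lim[of w]] by simp
  qed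
  also have "\<dots> \<le> liminf (\<lambda>k. \<integral>\<^sup>+w. log_kernel (z + s k * c * w) \<zeta> \<partial>circle_unif)"
    by (intro nn_integral_liminf continuous_on_measurable_circle cont sk)
  also have "\<dots> \<le> liminf (\<lambda>k::nat. log_kernel z \<zeta>)"
  proof (rule Liminf_mono, rule always_eventually, rule allI)
    fix k
    have "cmod (z - \<zeta>) \<noteq> cmod (s k * c)"
      using c s[of k] ac by (simp add: norm_mult)
    then show "(\<integral>\<^sup>+w. log_kernel (z + s k * c * w) \<zeta> \<partial>circle_unif) \<le> log_kernel z \<zeta>"
      by (rule log_kernel_supermean_generic[OF \<zeta> sk])
  qed
  also have "\<dots> = log_kernel z \<zeta>" by (simp add: Liminf_const)
  finally show ?thesis .
qed

text \<open>For \<open>|\<zeta>| = 1\<close> the Poisson kernel is the real part of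
  \<open>(\<zeta> + x) / (\<zeta> - x)\<close>, holomorphic in the disk, so the mean value property
  even gives equality.\<close>

lemma poisson_kernel_supermean:
  assumes \<zeta>: "cmod \<zeta> = 1" and z: "cmod z + cmod c < 1"
  shows "(\<integral>\<^sup>+w. ennreal ((1 - (cmod (z + c * w))\<^sup>2) / (cmod (\<zeta> - (z + c * w)))\<^sup>2) \<partial>circle_unif)
    \<le> ennreal ((1 - (cmod z)\<^sup>2) / (cmod (\<zeta> - z))\<^sup>2)"
proof -
  define H where "H = (\<lambda>x. (\<zeta> + x) / (\<zeta> - x))"
  have P: "(1 - (cmod x)\<^sup>2) / (cmod (\<zeta> - x))\<^sup>2 = Re (H x)" for x
  proof -
    have "Re (H x) = Re ((\<zeta> + x) * cnj (\<zeta> - x)) / (cmod (\<zeta> - x))\<^sup>2"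
      unfolding H_def by (simp only: complex_div_cnj[of "\<zeta> + x"] Re_divide_of_real)
    also have "Re ((\<zeta> + x) * cnj (\<zeta> - x)) = (cmod \<zeta>)\<^sup>2 - (cmod x)\<^sup>2"
      by (simp only: cmod_power2) (simp add: power2_eq_square algebra_simps)
    finally show ?thesis using \<zeta> by simp
  qed
  have "\<exists>s>1. cmod z + cmod c * s \<le> 1"
  proof (cases "c = 0")
    case False
    then show ?thesis using z
      by (intro exI[of _ "(1 - cmod z) / cmod c"]) (auto simp: field_simps)
  qed (use z in \<open>auto intro: exI[of _ 2]\<close>)
  then obtain s where s: "s > 1" "cmod z + cmod c * s \<le> 1" by blast
  have in_disk: "cmod (z + c * w) < 1" if "w \<in> ball 0 s" for w
  proof (cases "c = 0")
    case False
    then have "cmod c * cmod w < cmod c * s" using that by (intro mult_strict_left_mono) auto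
    then show ?thesis using s norm_triangle_ineq[of z "c * w"] by (simp add: norm_mult)
  qed (use z in auto)
  have hol: "(\<lambda>w. H (z + c * w)) holomorphic_on ball 0 s"
    unfolding H_def using in_disk \<zeta> by (intro holomorphic_intros) fastforce
  have "continuous_on (sphere 0 1) (\<lambda>w. H (z + c * w))"
    by (rule continuous_on_subset[OF holomorphic_on_imp_continuous_on[OF hol]]) (use s in auto)
  then have i: "integrable circle_unif (\<lambda>w. Re (H (z + c * w)))"
    by (intro continuous_on_integrable_circle continuous_intros)
  have "(\<integral>\<^sup>+w. ennreal (Re (H (z + c * w))) \<partial>circle_unif) = ennreal (LINT w|circle_unif. Re (H (z + c * w)))"
  proof (intro nn_integral_eq_integral i AE_I2)
    fix w assume "w \<in> space circle_unif"
    then have "cmod (z + c * w) < 1" using in_disk s by simp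
    then show "0 \<le> Re (H (z + c * w))"
      unfolding P[symmetric] by (simp add: power_le_one)
  qed
  also have "\<dots> = ennreal (Re (H z))"
    using circle_mean_value_Re[OF hol s(1)] by simp
  finally show ?thesis unfolding P by simp
qed

section \<open>Truncation and passage to unbounded weights on the whole disk\<close>

lemma circle_supermean_min:
  assumes "circle_supermean W"
  shows "circle_supermean (\<lambda>z. min (W z) C)"
  unfolding circle_supermean_def
proof (intro allI impI)
  fix z c :: complex assume "cmod z + cmod c < 1"
  then have "(\<integral>\<^sup>+w. W (z + c * w) \<partial>circle_unif) \<le> W z"
    using assms by (simp add: circle_supermean_def)
  moreover have "(\<integral>\<^sup>+w. min (W (z + c * w)) C \<partial>circle_unif) \<le> (\<integral>\<^sup>+w. W (z + c * w) \<partial>circle_unif)"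
    by (intro nn_integral_mono) simp
  moreover have "(\<integral>\<^sup>+w. min (W (z + c * w)) C \<partial>circle_unif) \<le> (\<integral>\<^sup>+w. C \<partial>circle_unif)"
    by (intro nn_integral_mono) simp
  ultimately show "(\<integral>\<^sup>+w. min (W (z + c * w)) C \<partial>circle_unif) \<le> min (W z) C"
    by (simp add: emeasure_circle_unif)
qed

text \<open>The bounded case is applied to \<open>min W k\<close> on the disk of radius
  \<open>R k\<close>. As \<open>k\<close> grows, Fatou's lemma recovers the full left-hand side,
  while each right-hand side is at most the full integral.\<close>

lemma supermean_weight_dilation:
  assumes [measurable]: "W \<in> borel_measurable borel" and sup: "circle_supermean W"
    and hol: "F holomorphic_on ball 0 1" and r: "0 \<le> r" "r \<le> 1"
  shows "(\<integral>\<^sup>+z\<in>ball 0 1. ennreal (r * (cmod (F (of_real r * z)))\<^sup>2) * W z \<partial>lborel)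
    \<le> (\<integral>\<^sup>+z\<in>ball 0 1. ennreal ((cmod (F z))\<^sup>2) * W z \<partial>lborel)"
proof -
  define u where "u = (\<lambda>z. r * (cmod (F (of_real r * z)))\<^sup>2)"
  \<comment> \<open>The double successor starts the radii at 1/2, so that all of them are strictly
    positive.\<close>
  define R :: "nat \<Rightarrow> real" where "R k = 1 - inverse (real (Suc (Suc k)))" for k
  \<comment> \<open>The truncated weight is finite, so \<open>enn2real\<close> merely changes its
    type, even where \<open>W\<close> is infinite.\<close>
  define W' where "W' = (\<lambda>k z. enn2real (min (W z) (ennreal (real k))))"
  define A where "A = (\<lambda>k z. indicator (ball 0 (R k)) z * (W' k z * u z))"
  have R: "0 < R k" "R k < 1" for k by (auto simp: R_def field_simps)
  have R_lim: "R \<longlonglongrightarrow> 1"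
  proof -
    have "(\<lambda>k. 1 + - inverse (real (Suc (Suc k)))) \<longlonglongrightarrow> 1"
      using LIMSEQ_Suc[OF LIMSEQ_inverse_real_of_nat_add_minus[of 1]] .
    moreover have "R = (\<lambda>k. 1 + - inverse (real (Suc (Suc k))))"
      by (simp add: fun_eq_iff R_def)
    ultimately show ?thesis by simp
  qed
  have W': "ennreal (W' k z) = min (W z) (ennreal (real k))" for k z
    unfolding W'_def by (rule ennreal_enn2real) (simp add: min_less_iff_disj)
  have W'_meas [measurable]: "W' k \<in> borel_measurable borel" for k
    unfolding W'_def by measurable
  have W'_bounds: "0 \<le> W' k z" "W' k z \<le> real k" for k z
  proof -
    show "0 \<le> W' k z" by (simp add: W'_def)
    have "ennreal (W' k z) \<le> ennreal (real k)" unfolding W' by simp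
    then show "W' k z \<le> real k" by simp
  qed
  have W'_sup: "circle_supermean (\<lambda>z. ennreal (W' k z))" for k
    unfolding W' by (rule circle_supermean_min[OF sup])
  have cF: "continuous_on (ball 0 1) F" by (rule holomorphic_on_imp_continuous_on[OF hol])
  have cu: "continuous_on (ball 0 1) u"
  proof -
    have "continuous_on (ball 0 1) (\<lambda>z. F (of_real r * z))"
      using r by (intro holomorphic_on_imp_continuous_on holomorphic_on_dilation[OF hol]) auto
    then show ?thesis unfolding u_def by (intro continuous_intros)
  qed
  have cF2: "continuous_on (ball 0 1) (\<lambda>z. (cmod (F z))\<^sup>2)" by (intro continuous_intros cF)
  have u_nonneg: "0 \<le> u z" for z using r by (simp add: u_def)
  have A_int: "integrable lborel (A k)" for k
    unfolding A_def by (rule integrable_ball_weight[OF W'_meas W'_bounds cu R(2)])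
  have A_lim: "(\<lambda>k. ennreal (A k z)) \<longlonglongrightarrow> ennreal (u z) * W z * indicator (ball 0 1) z" for z
  proof (cases "z \<in> ball 0 1")
    case True
    have "(\<lambda>k. min (W z) (ennreal (real k))) \<longlonglongrightarrow> min (W z) top"
      using of_nat_tendsto_top_ennreal by (intro tendsto_intros) (simp add: ennreal_of_nat_eq_real_of_nat)
    then have "(\<lambda>k. ennreal (u z) * ennreal (W' k z)) \<longlonglongrightarrow> ennreal (u z) * W z"
      unfolding W' by (intro ennreal_tendsto_cmult) auto
    moreover have "\<forall>\<^sub>F k in sequentially. ennreal (u z) * ennreal (W' k z) = ennreal (A k z)"
      using order_tendstoD(1)[OF R_lim, of "cmod z"] True
      by (auto simp: A_def ennreal_mult' u_nonneg W'_bounds mult.commute elim!: eventually_mono)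
    ultimately show ?thesis
      using True by (auto intro: Lim_transform_eventually)
  next
    case False
    then have "A k z = 0" for k using R(2)[of k] by (auto simp: A_def)
    then show ?thesis using False by simp
  qed
  have "(\<integral>\<^sup>+z\<in>ball 0 1. ennreal (u z) * W z \<partial>lborel) = (\<integral>\<^sup>+z. liminf (\<lambda>k. ennreal (A k z)) \<partial>lborel)"
    by (intro nn_integral_cong lim_imp_Liminf[symmetric] A_lim) simp
  also have "\<dots> \<le> liminf (\<lambda>k. \<integral>\<^sup>+z. ennreal (A k z) \<partial>lborel)"
    using A_int by (intro nn_integral_liminf) auto
  also have "\<dots> \<le> liminf (\<lambda>k::nat. \<integral>\<^sup>+z\<in>ball 0 1. ennreal ((cmod (F z))\<^sup>2) * W z \<partial>lborel)"
  proof (rule Liminf_mono, rule always_eventually, rule allI)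
    fix k
    have "(\<integral>\<^sup>+z. ennreal (A k z) \<partial>lborel) = ennreal (integral\<^sup>L lborel (A k))"
      by (intro nn_integral_eq_integral A_int) (auto simp: A_def u_nonneg W'_bounds)
    also have "\<dots> \<le> ennreal (LINT z|lborel. indicator (ball 0 (R k)) z * (W' k z * (cmod (F z))\<^sup>2))"
      unfolding A_def u_def
      by (intro ennreal_leI supermean_weight_dilation_bounded[OF W'_meas W'_bounds W'_sup hol R r])
    also have "\<dots> = (\<integral>\<^sup>+z. ennreal (indicator (ball 0 (R k)) z * (W' k z * (cmod (F z))\<^sup>2)) \<partial>lborel)"
      by (intro nn_integral_eq_integral[symmetric] integrable_ball_weight[OF W'_meas W'_bounds cF2 R(2)])
         (auto simp: W'_bounds)
    also have "\<dots> \<le> (\<integral>\<^sup>+z\<in>ball 0 1. ennreal ((cmod (F z))\<^sup>2) * W z \<partial>lborel)"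
    proof (rule nn_integral_mono)
      fix z
      have "ennreal (W' k z * (cmod (F z))\<^sup>2) = ennreal ((cmod (F z))\<^sup>2) * min (W z) (ennreal (real k))"
        by (simp add: ennreal_mult W'_bounds W' mult.commute)
      also have "\<dots> \<le> ennreal ((cmod (F z))\<^sup>2) * W z"
        by (intro mult_left_mono) auto
      finally show "ennreal (indicator (ball 0 (R k)) z * (W' k z * (cmod (F z))\<^sup>2))
          \<le> ennreal ((cmod (F z))\<^sup>2) * W z * indicator (ball 0 1) z"
        using R(2)[of k] by (auto simp: indicator_def)
    qed
    finally show "(\<integral>\<^sup>+z. ennreal (A k z) \<partial>lborel) \<le> (\<integral>\<^sup>+z\<in>ball 0 1. ennreal ((cmod (F z))\<^sup>2) * W z \<partial>lborel)" .
  qed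
  finally show ?thesis by (simp add: u_def Liminf_const)
qed

section \<open>Measurability and circular means of the superharmonic weight\<close>

lemma log_kernel_measurable [measurable (raw)]:
  assumes [measurable]: "f \<in> borel_measurable M" "g \<in> borel_measurable M"
  shows "(\<lambda>x. log_kernel (f x) (g x)) \<in> borel_measurable M"
proof -
  have [measurable]: "(\<lambda>x. cnj (g x)) \<in> borel_measurable M"
    by (rule borel_measurable_continuous_on[OF _ assms(2)]) (intro continuous_intros)
  show ?thesis unfolding log_kernel_def by measurable
qed

lemma ball_sphere_borel [measurable]:
  fixes c :: "'a::euclidean_space"
  shows "ball c r \<in> sets borel" "sphere c r \<in> sets borel"
  by (auto intro: borel_open borel_closed)

lemma finite_borel_measure_on_cdisk_measurable_ident:
  assumes "finite_borel_measure_on_cdisk \<mu>"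
  shows "(\<lambda>\<zeta>. \<zeta>) \<in> borel_measurable \<mu>"
proof -
  have "(\<lambda>\<zeta>. \<zeta>) \<in> borel_measurable (restrict_space borel (cball 0 1 :: complex set))"
    by (rule measurable_restrict_space1) simp
  then show ?thesis
    using assms by (simp add: finite_borel_measure_on_cdisk_def cong: measurable_cong_sets)
qed

text \<open>\<open>\<mu>\<close> carries the sigma-algebra of the closed disk. Its image under the
  inclusion is a Borel measure on the plane with the same integrals, for which joint measurability
  of the kernels is directly available.\<close>

lemma superharmonic_weight_distr_borel:
  assumes "finite_borel_measure_on_cdisk \<mu>"
  shows "superharmonic_weight \<mu> = superharmonic_weight (distr \<mu> borel (\<lambda>\<zeta>. \<zeta>))"
proof
  fix z
  note distr = nn_integral_distr[OF finite_borel_measure_on_cdisk_measurable_ident[OF assms]]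
  show "superharmonic_weight \<mu> z = superharmonic_weight (distr \<mu> borel (\<lambda>\<zeta>. \<zeta>)) z"
    unfolding superharmonic_weight_def by (intro arg_cong2[where f = "(+)"] distr[symmetric]) measurable
qed

lemma superharmonic_weight_measurable:
  assumes fin: "finite_measure \<nu>" and [measurable_cong]: "sets \<nu> = sets borel"
  shows "superharmonic_weight \<nu> \<in> borel_measurable borel"
proof -
  interpret finite_measure \<nu> by (rule fin)
  show ?thesis unfolding superharmonic_weight_def[abs_def] by measurable
qed

text \<open>By Tonelli's theorem the mean over the circle can be taken inside the integral over
  \<open>\<zeta>\<close>, where the two kernel estimates apply; the density
  \<open>2 / (1 - (cmod \<zeta>)\<^sup>2)\<close> is constant in \<open>w\<close>.\<close>

lemma circle_supermean_superharmonic_weight: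
  assumes fin: "finite_measure \<nu>" and [measurable_cong]: "sets \<nu> = sets borel"
  shows "circle_supermean (superharmonic_weight \<nu>)"
  unfolding circle_supermean_def
proof (intro allI impI)
  fix z c :: complex assume z: "cmod z + cmod c < 1"
  interpret finite_measure \<nu> by (rule fin)
  interpret P: pair_sigma_finite circle_unif \<nu>
    by (intro pair_sigma_finite.intro circle.sigma_finite_measure_axioms sigma_finite_measure_axioms)
  have [measurable]: "(\<lambda>w. w) \<in> borel_measurable circle_unif"
    by (intro continuous_on_measurable_circle continuous_intros)
  let ?K = "\<lambda>w \<zeta>. log_kernel (z + c * w) \<zeta> * ennreal (2 / (1 - (cmod \<zeta>)\<^sup>2)) * indicator (ball 0 1) \<zeta>"
  let ?P = "\<lambda>w \<zeta>. ennreal ((1 - (cmod (z + c * w))\<^sup>2) / (cmod (\<zeta> - (z + c * w)))\<^sup>2) * indicator (sphere 0 1) \<zeta>"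
  have K: "(\<integral>\<^sup>+w. \<integral>\<^sup>+\<zeta>. ?K w \<zeta> \<partial>\<nu> \<partial>circle_unif)
      \<le> (\<integral>\<^sup>+\<zeta>\<in>ball 0 1. log_kernel z \<zeta> * ennreal (2 / (1 - (cmod \<zeta>)\<^sup>2)) \<partial>\<nu>)"
  proof -
    have "(\<integral>\<^sup>+w. \<integral>\<^sup>+\<zeta>. ?K w \<zeta> \<partial>\<nu> \<partial>circle_unif) = (\<integral>\<^sup>+\<zeta>. \<integral>\<^sup>+w. ?K w \<zeta> \<partial>circle_unif \<partial>\<nu>)"
      by (subst P.Fubini') measurable
    also have "\<dots> \<le> (\<integral>\<^sup>+\<zeta>\<in>ball 0 1. log_kernel z \<zeta> * ennreal (2 / (1 - (cmod \<zeta>)\<^sup>2)) \<partial>\<nu>)"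
    proof (rule nn_integral_mono)
      fix \<zeta>
      show "(\<integral>\<^sup>+w. ?K w \<zeta> \<partial>circle_unif) \<le> log_kernel z \<zeta> * ennreal (2 / (1 - (cmod \<zeta>)\<^sup>2)) * indicator (ball 0 1) \<zeta>"
        using log_kernel_supermean[OF _ z, of \<zeta>]
        by (cases "\<zeta> \<in> ball 0 1") (auto simp: nn_integral_multc intro!: mult_right_mono)
    qed
    finally show ?thesis .
  qed
  have P: "(\<integral>\<^sup>+w. \<integral>\<^sup>+\<zeta>. ?P w \<zeta> \<partial>\<nu> \<partial>circle_unif)
      \<le> (\<integral>\<^sup>+\<zeta>\<in>sphere 0 1. ennreal ((1 - (cmod z)\<^sup>2) / (cmod (\<zeta> - z))\<^sup>2) \<partial>\<nu>)"
  proof -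
    have "(\<integral>\<^sup>+w. \<integral>\<^sup>+\<zeta>. ?P w \<zeta> \<partial>\<nu> \<partial>circle_unif) = (\<integral>\<^sup>+\<zeta>. \<integral>\<^sup>+w. ?P w \<zeta> \<partial>circle_unif \<partial>\<nu>)"
      by (subst P.Fubini') measurable
    also have "\<dots> \<le> (\<integral>\<^sup>+\<zeta>\<in>sphere 0 1. ennreal ((1 - (cmod z)\<^sup>2) / (cmod (\<zeta> - z))\<^sup>2) \<partial>\<nu>)"
    proof (rule nn_integral_mono)
      fix \<zeta>
      show "(\<integral>\<^sup>+w. ?P w \<zeta> \<partial>circle_unif) \<le> ennreal ((1 - (cmod z)\<^sup>2) / (cmod (\<zeta> - z))\<^sup>2) * indicator (sphere 0 1) \<zeta>"
        using poisson_kernel_supermean[OF _ z, of \<zeta>]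
        by (cases "\<zeta> \<in> sphere 0 1") auto
    qed
    finally show ?thesis .
  qed
  have "(\<integral>\<^sup>+w. superharmonic_weight \<nu> (z + c * w) \<partial>circle_unif)
      = (\<integral>\<^sup>+w. \<integral>\<^sup>+\<zeta>. ?K w \<zeta> \<partial>\<nu> \<partial>circle_unif) + (\<integral>\<^sup>+w. \<integral>\<^sup>+\<zeta>. ?P w \<zeta> \<partial>\<nu> \<partial>circle_unif)"
    unfolding superharmonic_weight_def by (rule nn_integral_add) measurable
  also have "\<dots> \<le> superharmonic_weight \<nu> z"
    unfolding superharmonic_weight_def by (rule add_mono[OF K P])
  finally show "(\<integral>\<^sup>+w. superharmonic_weight \<nu> (z + c * w) \<partial>circle_unif) \<le> superharmonic_weight \<nu> z" .
qed

lemma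
  assumes "finite_borel_measure_on_cdisk \<mu>"
  shows superharmonic_weight_borel: "superharmonic_weight \<mu> \<in> borel_measurable borel"
    and superharmonic_weight_supermean: "circle_supermean (superharmonic_weight \<mu>)"
proof -
  have fin: "finite_measure (distr \<mu> borel (\<lambda>\<zeta>. \<zeta>))"
    using assms by (intro finite_measure.finite_measure_distr) (auto simp: finite_borel_measure_on_cdisk_def
        finite_borel_measure_on_cdisk_measurable_ident[OF assms])
  show "superharmonic_weight \<mu> \<in> borel_measurable borel" "circle_supermean (superharmonic_weight \<mu>)"
    unfolding superharmonic_weight_distr_borel[OF assms]
    by (intro superharmonic_weight_measurable circle_supermean_superharmonic_weight fin; simp)+
qed

section \<open>The Dirichlet integral of a dilate\<close>

text \<open>Separates the normalizing area from the integral. Holomorphy controls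
  \<open>deriv f\<close> only inside the disk, so measurability is obtained for the integrand with
  the indicator absorbed into \<open>|f'|\<^sup>2\<close>.\<close>

lemma dirichlet_integral_lborel:
  assumes mu: "finite_borel_measure_on_cdisk \<mu>" and hol: "f holomorphic_on ball 0 1"
  shows "dirichlet_integral \<mu> f =
    (\<integral>\<^sup>+z\<in>ball 0 1. ennreal ((cmod (deriv f z))\<^sup>2) * superharmonic_weight \<mu> z \<partial>lborel) / emeasure lborel (ball (0::complex) 1)"
proof -
  note [measurable] = superharmonic_weight_borel[OF mu]
  have "continuous_on (ball 0 1) (\<lambda>z. (cmod (deriv f z))\<^sup>2)"
    by (intro continuous_intros holomorphic_on_imp_continuous_on holomorphic_deriv[OF hol]) auto
  then have [measurable]: "(\<lambda>z. indicator (ball 0 1) z * (cmod (deriv f z))\<^sup>2) \<in> borel_measurable borel"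
    by (rule borel_measurable_indicator_ball)
  have "ennreal ((cmod (deriv f z))\<^sup>2) * superharmonic_weight \<mu> z * indicator (ball 0 1) z
     = ennreal (indicator (ball 0 1) z * (cmod (deriv f z))\<^sup>2) * superharmonic_weight \<mu> z" for z
    by (cases "z \<in> ball 0 1") auto
  then show ?thesis
    unfolding dirichlet_integral_def
    by (simp add: nn_integral_uniform_measure mult.assoc)
       (intro arg_cong2[where f = "(/)"] nn_integral_cong refl, auto simp: indicator_def)
qed

theorem theorem4p2:
  fixes \<mu> :: "complex measure" and f :: "complex \<Rightarrow> complex" and r :: real
  assumes "finite_borel_measure_on_cdisk \<mu>"
    and "f \<in> dirichlet_space \<mu>"
    and "0 \<le> r" and "r < 1"
  shows "dirichlet_integral \<mu> (\<lambda>z. f (of_real r * z))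
           \<le> ennreal (2 * r / (1 + r)) * dirichlet_integral \<mu> f"
proof -
  note mu = assms(1) and r = assms(3,4)
  have hol: "f holomorphic_on ball 0 1" using assms(2) by (simp add: dirichlet_space_def)
  have hol': "deriv f holomorphic_on ball 0 1" by (rule holomorphic_deriv[OF hol]) auto
  let ?\<omega> = "superharmonic_weight \<mu>"
  let ?A = "emeasure lborel (ball (0::complex) 1)"
  have r01: "r \<in> {0..1}" using r by simp
  have "dirichlet_integral \<mu> (\<lambda>z. f (of_real r * z)) =
      (\<integral>\<^sup>+z\<in>ball 0 1. ennreal ((cmod (deriv (\<lambda>z. f (of_real r * z)) z))\<^sup>2) * ?\<omega> z \<partial>lborel) / ?A"
    by (rule dirichlet_integral_lborel[OF mu holomorphic_on_dilation[OF hol r01]])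
  \<comment> \<open>The chain rule produces \<open>r\<^sup>2\<close>. One factor \<open>r\<close> is
    pulled out as the final constant, the other stays inside to match the dilation inequality for
    \<open>F = deriv f\<close>.\<close>
  also have "(\<integral>\<^sup>+z\<in>ball 0 1. ennreal ((cmod (deriv (\<lambda>z. f (of_real r * z)) z))\<^sup>2) * ?\<omega> z \<partial>lborel)
      = (\<integral>\<^sup>+z. ennreal r * (ennreal (r * (cmod (deriv f (of_real r * z)))\<^sup>2) * ?\<omega> z * indicator (ball 0 1) z) \<partial>lborel)"
  proof (rule nn_integral_cong)
    fix z :: complex
    show "ennreal ((cmod (deriv (\<lambda>z. f (of_real r * z)) z))\<^sup>2) * ?\<omega> z * indicator (ball 0 1) z
      = ennreal r * (ennreal (r * (cmod (deriv f (of_real r * z)))\<^sup>2) * ?\<omega> z * indicator (ball 0 1) z)"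
    proof (cases "z \<in> ball 0 1")
      case True
      have "(cmod (deriv (\<lambda>z. f (of_real r * z)) z))\<^sup>2 = r * (r * (cmod (deriv f (of_real r * z)))\<^sup>2)"
        using r by (simp add: deriv_dilation[OF hol r01 True] norm_mult power_mult_distrib power2_eq_square)
      then show ?thesis using r by (simp only: ennreal_mult' mult.assoc)
    qed simp
  qed
  also have "\<dots> = ennreal r * (\<integral>\<^sup>+z\<in>ball 0 1. ennreal (r * (cmod (deriv f (of_real r * z)))\<^sup>2) * ?\<omega> z \<partial>lborel)"
  proof (rule nn_integral_cmult)
    note [measurable] = superharmonic_weight_borel[OF mu]
    have "continuous_on (ball 0 1) (\<lambda>z. deriv f (of_real r * z))"
      by (intro holomorphic_on_imp_continuous_on holomorphic_on_dilation[OF hol' r01])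
    then have "continuous_on (ball 0 1) (\<lambda>z. r * (cmod (deriv f (of_real r * z)))\<^sup>2)"
      by (intro continuous_intros)
    then have [measurable]: "(\<lambda>z. indicator (ball 0 1) z * (r * (cmod (deriv f (of_real r * z)))\<^sup>2)) \<in> borel_measurable borel"
      by (rule borel_measurable_indicator_ball)
    have "(\<lambda>z. ennreal (indicator (ball 0 1) z * (r * (cmod (deriv f (of_real r * z)))\<^sup>2)) * ?\<omega> z) \<in> borel_measurable lborel"
      by measurable
    also have "(\<lambda>z. ennreal (indicator (ball 0 1) z * (r * (cmod (deriv f (of_real r * z)))\<^sup>2)) * ?\<omega> z)
       = (\<lambda>z. ennreal (r * (cmod (deriv f (of_real r * z)))\<^sup>2) * ?\<omega> z * indicator (ball 0 1) z)"
      by (auto simp: fun_eq_iff indicator_def)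
    finally show "\<dots> \<in> borel_measurable lborel" .
  qed
  also have "\<dots> / ?A \<le> ennreal r * (\<integral>\<^sup>+z\<in>ball 0 1. ennreal ((cmod (deriv f z))\<^sup>2) * ?\<omega> z \<partial>lborel) / ?A"
    using supermean_weight_dilation[OF superharmonic_weight_borel[OF mu]
        superharmonic_weight_supermean[OF mu] hol'] r
    by (intro divide_right_mono_ennreal mult_left_mono) auto
  also have "\<dots> = ennreal r * dirichlet_integral \<mu> f"
    by (simp add: dirichlet_integral_lborel[OF mu hol] ennreal_times_divide)
  \<comment> \<open>The sharper constant \<open>r\<close> has been reached; it is at most
    \<open>2 * r / (1 + r)\<close> because \<open>1 + r \<le> 2\<close>.\<close>
  also have "\<dots> \<le> ennreal (2 * r / (1 + r)) * dirichlet_integral \<mu> f"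
  proof (intro mult_right_mono ennreal_leI)
    have "r * r \<le> r * 1" using r by (intro mult_left_mono) auto
    then show "r \<le> 2 * r / (1 + r)" using r by (simp add: field_simps)
  qed simp
  finally show ?thesis .
qed

end
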